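(* Let $\mathcal{X}\subset\mathbb{R}^d$ be closed and convex, and let $f,g$ be continuous on $\mathcal{X}$ with $\partial f(x)\neq\emptyset$, $\partial g(x)\neq\emptyset$ for all $x\in\mathcal{X}$. Suppose there is $M>0$ with $\|\zeta_f\|\le M$, $\|\zeta_g\|\le M$ for all $x\in\mathcal{X}$, $\zeta_f\in\partial f(x)$, $\zeta_g\in\partial g(x)$. Suppose that $f$ is $\rho$-weakly convex on $\mathcal{X}$ and $g$ is convex on $\mathcal{X}$; that there is $x_{\mathrm{feas}}\in\mathrm{relint}(\mathcal{X})$ with $g(x_{\mathrm{feas}})<0$; and that there is $D>0$ with $\|x-x'\|\le D$ for all $x,x'\in\mathcal{X}$. Suppose stochastic oracles are available: for any $x\in\mathcal{X}$, stochastic subgradients $\xi_f,\xi_g$ and a stochastic value $\omega$ can be generated independently with $\mathbb{E}[\omega]=g(x)$, $\mathbb{E}[\xi_f]\in\partial f(x)$, $\mathbb{E}[\xi_g]\in\partial g(x)$, $\mathbb{E}[\exp(\|\xi_f\|^2/M^2)]\le e$, $\mathbb{E}[\exp(\|\xi_g\|^2/M^2)]\le e$ and $\mathbb{E}[\exp((\omega-g(x))^2/\sigma^2)]\le e$ for a constant $\sigma$ independent of $x$. Let $\hat\rho>\rho$, $\Lambda:=(MD+\hat\rho D^2)/(-g(x_{\mathrm{feas}}))$, $\epsilon>0$, $\delta\in(0,1)$, and $$\widehat{x}^{(t)}:=\arg\min_{y\in\mathcal{X}}\Big\{f(y)+\tfrac{\hat\rho}{2}\|y-x^{(t)}\|^2:\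 g(y)\le0\Big\}.$$ Let $x^{(\tau)}$ be generated by the stochastic switching subgradient method (described in the context). Then, with probability at least $1-\delta$, $$\mathbb{E}_\tau\big[\|\widehat{x}^{(\tau)}-x^{(\tau)}\|\big]\le\epsilon\quad\text{and}\quad\mathbb{E}_\tau\big[g(x^{(\tau)})\big]\le\frac{2\epsilon^2(\hat\rho-\rho)}{1+\Lambda}$$ in either of the following cases. Case I: $S=0$, $\epsilon_t=\frac{\epsilon^2(\hat\rho-\rho)}{1+\Lambda}$, $\eta_t=\frac{2\epsilon^2(\hat\rho-\rho)}{5(1+\Lambda)M^2}$, $$T\ge\max\left\{\frac{25M^2D^2(1+\Lambda)^2}{4\epsilon^4(\hat\rho-\rho)^2},\ \max\Big\{12\ln(8/\delta),\tfrac{16}{9}\ln^2(8/\delta)\Big\},\ \frac{300\ln(4/\delta)M^2D^2(1+\Lambda)^2}{\epsilon^4(\hat\rho-\rho)^2}\right\},$$ and $B=\frac{300\sigma^2\ln(4T/\delta)(1+\Lambda)^4}{\epsilon^4(\hat\rho-\rho)^2}$ (rounded up to a positive integer). Case II: $S=T/2$, $\eta_t=\frac{D}{M\sqrt{t+1}}$, $\epsilon_t=\frac{EMD}{\sqrt{t+1}}$, where $E$ is any positive constant with $$E\ge8+\frac{2\pi}{\sqrt6}\max\left\{\sqrt{12\ln(8/\delta)},\tfrac43\ln(8/\delta)\right\}+8\sqrt{3\ln(4/\delta)},$$ $T\ge\frac{2E^2M^2D^2(1+\Lambda)^2}{\epsilon^4(\hat\rho-\rho)^2}$, and $B=\frac{3T\sigma^2\ln(2T/\delta)(1+\Lambda)^2}{2M^2D^2}$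 (rounded up to a positive integer).
   Context: $\|\cdot\|$ is the Euclidean norm. For $h:\mathbb{R}^d\to\mathbb{R}\cup\{+\infty\}$, $\partial h(x)=\{\zeta\in\mathbb{R}^d: h(x')\ge h(x)+\langle\zeta,x'-x\rangle+o(\|x'-x\|),\ x'\to x\}$. $h$ is $\rho$-weakly convex on $\mathcal{X}$ ($\rho\ge0$) if $h(x)\ge h(x')+\langle\zeta,x-x'\rangle-\frac{\rho}{2}\|x-x'\|^2$ for all $x,x'\in\mathcal{X}$ and $\zeta\in\partial h(x')$; convex on $\mathcal{X}$ is the case $\rho=0$. The problem under study is $\min_{x\in\mathcal{X}}f(x)$ subject to $g(x)\le0$. $\mathrm{proj}_{\mathcal X}$ is Euclidean projection onto $\mathcal{X}$; relint is relative interior. Convention: $\sigma=0$ when $\omega=g(x)$ deterministically. Stochastic switching subgradient method. Input: $x^{(0)}\in\mathcal{X}$, number of iterations $T$ (a positive integer), tolerances $\epsilon_t\ge0$, stepsizes $\eta_t$, mini-batch size $B$, and an integer starting index $S$. Initialize $I=J=\emptyset$. For $t=0,1,\dots,T-1$: generate a mini-batch $\omega_1^{(t)},\dots,\omega_B^{(t)}$ of independent stochastic estimators of $g(x^{(t)})$ and set $\bar\omega^{(t)}=\frac1B\sum_{i=1}^B\omega_i^{(t)}$. If $\bar\omega^{(t)}\le\epsilon_t$, generate a stochastic subgradient $\xi_f^{(t)}$ of $f$ at $x^{(t)}$, set $x^{(t+1)}=\mathrm{proj}_{\mathcal X}(x^{(t)}-\eta_t\xi_f^{(t)})$ and, if $t\ge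 S$, add $t$ to $I$; otherwise generate a stochastic subgradient $\xi_g^{(t)}$ of $g$ at $x^{(t)}$, set $x^{(t+1)}=\mathrm{proj}_{\mathcal X}(x^{(t)}-\eta_t\xi_g^{(t)})$ and, if $t\ge S$, add $t$ to $J$. Conditionally on everything generated before iteration $t$, the oracle outputs at iteration $t$ are independent and follow the oracle distributions at $x^{(t)}$. Output: $x^{(\tau)}$ with $\tau$ sampled from $I$ with $\mathrm{Prob}(\tau=t)=\eta_t/\sum_{s\in I}\eta_s$. $\mathbb{E}_\tau$ is the expectation over the random index $\tau$ only (conditionally on the iterates); "with probability at least $1-\delta$" refers to the randomness of the oracles. A guarantee about $x^{(\tau)}$ is understood to include that $I$ is nonempty. *)

theory Defs
  imports "HOL-Probability.Probability" "HOL-Library.Landau_Symbols"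
begin

text \<open>
  Functions into the reals extended by plus infinity are rendered as \<^typ>\<open>ereal\<close>-valued
  functions; that minus infinity is not attained is assumed where it is needed.
\<close>

definition subdiff :: "('a::euclidean_space \<Rightarrow> ereal) \<Rightarrow> 'a \<Rightarrow> 'a set" where
  "subdiff h x = {\<zeta>. \<exists>r::'a \<Rightarrow> real. r \<in> o[at x](\<lambda>x'. norm (x' - x)) \<and>
     (\<forall>\<^sub>F x' in at x. h x' \<ge> h x + ereal (\<zeta> \<bullet> (x' - x) + r x'))}"

definition weakly_convex_on :: "real \<Rightarrow> 'a::euclidean_space set \<Rightarrow> ('a \<Rightarrow> ereal) \<Rightarrow> bool" where
  "weakly_convex_on \<rho> X h \<longleftrightarrow>
     (\<forall>x\<in>X. \<forall>x'\<in>X. \<forall>\<zeta>\<in>subdiff h x'.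
        h x \<ge> h x' + ereal (\<zeta> \<bullet> (x - x') - \<rho> / 2 * (norm (x - x'))\<^sup>2))"

text \<open>
  An oracle is given by the family of its output distributions, indexed by the query point.
  Exponential moments are Lebesgue integrals in \<^typ>\<open>ennreal\<close>, so that the bounds include finiteness.
\<close>

definition subgradient_oracle ::
  "('a::euclidean_space \<Rightarrow> ereal) \<Rightarrow> 'a set \<Rightarrow> real \<Rightarrow> ('a \<Rightarrow> 'a measure) \<Rightarrow> bool" where
  "subgradient_oracle h X M P \<longleftrightarrow>
     (\<forall>x\<in>X. prob_space (P x) \<and> sets (P x) = sets borel \<and>
        integrable (P x) (\<lambda>\<xi>. \<xi>) \<and> (\<integral>\<xi>. \<xi> \<partial>P x) \<in> subdiff h x \<and>
        (\<integral>\<^sup>+\<xi>. ennreal (exp ((norm \<xi>)\<^sup>2 / M\<^sup>2)) \<partial>P x) \<le> ennreal (exp 1))"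

text \<open>The value \<open>\<sigma> = 0\<close> stands for an exact oracle; the moment bound would divide by zero there.\<close>

definition value_oracle ::
  "('a::euclidean_space \<Rightarrow> ereal) \<Rightarrow> 'a set \<Rightarrow> real \<Rightarrow> ('a \<Rightarrow> real measure) \<Rightarrow> bool" where
  "value_oracle h X \<sigma> Q \<longleftrightarrow> \<sigma> \<ge> 0 \<and>
     (\<forall>x\<in>X. prob_space (Q x) \<and> sets (Q x) = sets borel \<and>
        integrable (Q x) (\<lambda>\<omega>. \<omega>) \<and> ereal (\<integral>\<omega>. \<omega> \<partial>Q x) = h x \<and>
        (if \<sigma> = 0 then (AE \<omega> in Q x. ereal \<omega> = h x)
         else (\<integral>\<^sup>+\<omega>. ennreal (exp ((\<omega> - real_of_ereal (h x))\<^sup>2 / \<sigma>\<^sup>2)) \<partial>Q x) \<le> ennreal (exp 1)))"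

text \<open>
  The oracle outputs of one iteration are a triple \<open>(\<omega>, \<xi>\<^sub>f, \<xi>\<^sub>g)\<close>, where \<open>\<omega>\<close> is a mini-batch
  indexed by \<open>{..<B}\<close>. Both subgradients are present in the triple, but an iteration uses only
  the one selected by the mini-batch; the other one has no influence on the iterates.
\<close>

type_synonym 'a outputs = "(nat \<Rightarrow> real) \<times> 'a \<times> 'a"

definition outputs_space :: "nat \<Rightarrow> 'a::euclidean_space outputs measure" where
  "outputs_space B = (\<Pi>\<^sub>M i\<in>{..<B}. borel) \<Otimes>\<^sub>M (borel \<Otimes>\<^sub>M borel)"

definition outputs_law ::
  "nat \<Rightarrow> ('a::euclidean_space \<Rightarrow> real measure) \<Rightarrow> ('a \<Rightarrow> 'a measure) \<Rightarrow> ('a \<Rightarrow> 'a measure) \<Rightarrow>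
   'a \<Rightarrow> 'a outputs measure" where
  "outputs_law B Q Pf Pg x = (\<Pi>\<^sub>M i\<in>{..<B}. Q x) \<Otimes>\<^sub>M (Pf x \<Otimes>\<^sub>M Pg x)"

definition f_step :: "nat \<Rightarrow> (nat \<Rightarrow> real) \<Rightarrow> (nat \<Rightarrow> 'a outputs) \<Rightarrow> nat \<Rightarrow> bool" where
  "f_step B tol z t \<longleftrightarrow> (\<Sum>i<B. fst (z t) i) / real B \<le> tol t"

primrec iterate ::
  "'a::euclidean_space set \<Rightarrow> nat \<Rightarrow> (nat \<Rightarrow> real) \<Rightarrow> (nat \<Rightarrow> real) \<Rightarrow> 'a \<Rightarrow>
   (nat \<Rightarrow> 'a outputs) \<Rightarrow> nat \<Rightarrow> 'a" where
  "iterate X B tol \<eta> x0 z 0 = x0"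
| "iterate X B tol \<eta> x0 z (Suc t) =
     closest_point X (iterate X B tol \<eta> x0 z t -
       \<eta> t *\<^sub>R (if f_step B tol z t then fst (snd (z t)) else snd (snd (z t))))"

definition index_set :: "nat \<Rightarrow> nat \<Rightarrow> nat \<Rightarrow> (nat \<Rightarrow> real) \<Rightarrow> (nat \<Rightarrow> 'a outputs) \<Rightarrow> nat set" where
  "index_set S T B tol z = {t. S \<le> t \<and> t < T \<and> f_step B tol z t}"

text \<open>Meaningful only if \<open>I\<close> is finite and nonempty and \<open>\<eta>\<close> is positive on \<open>I\<close>.\<close>

definition tau_pmf :: "(nat \<Rightarrow> real) \<Rightarrow> nat set \<Rightarrow> nat pmf" where
  "tau_pmf \<eta> I = embed_pmf (\<lambda>t. if t \<in> I then \<eta> t / (\<Sum>s\<in>I. \<eta> s) else 0)"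

definition past ::
  "'w measure \<Rightarrow> nat \<Rightarrow> (nat \<Rightarrow> 'w \<Rightarrow> 'a::euclidean_space outputs) \<Rightarrow> nat \<Rightarrow> 'w measure" where
  "past \<Omega> B Z t = vimage_algebra (space \<Omega>) (\<lambda>w. \<lambda>s\<in>{..<t}. Z s w) (\<Pi>\<^sub>M s\<in>{..<t}. outputs_space B)"

text \<open>
  \<open>Z t\<close> is the random triple of oracle outputs at iteration \<open>t\<close>. Its conditional distribution given
  the past is the product of the oracle distributions at the current iterate. Since the conditional
  expectation is a measurable version, measurability of the oracles in the query point
  need not be assumed.
\<close>

definition switching_run ::
  "'w measure \<Rightarrow> 'a::euclidean_space set \<Rightarrow> nat \<Rightarrow> nat \<Rightarrow> (nat \<Rightarrow> real) \<Rightarrow> (nat \<Rightarrow> real) \<Rightarrow> 'a \<Rightarrow>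
   ('a \<Rightarrow> real measure) \<Rightarrow> ('a \<Rightarrow> 'a measure) \<Rightarrow> ('a \<Rightarrow> 'a measure) \<Rightarrow>
   (nat \<Rightarrow> 'w \<Rightarrow> 'a outputs) \<Rightarrow> bool" where
  "switching_run \<Omega> X T B tol \<eta> x0 Q Pf Pg Z \<longleftrightarrow>
     prob_space \<Omega> \<and> x0 \<in> X \<and>
     (\<forall>t<T. Z t \<in> measurable \<Omega> (outputs_space B) \<and>
        (\<forall>A\<in>sets (outputs_space B). AE w in \<Omega>.
           real_cond_exp \<Omega> (past \<Omega> B Z t) (indicator (Z t -` A \<inter> space \<Omega>)) w =
           measure (outputs_law B Q Pf Pg (iterate X B tol \<eta> x0 (\<lambda>s. Z s w) t)) A))"

definition prox_point ::
  "'a::euclidean_space set \<Rightarrow> ('a \<Rightarrow> ereal) \<Rightarrow> ('a \<Rightarrow> ereal) \<Rightarrow> real \<Rightarrow> 'a \<Rightarrow> 'a" where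
  "prox_point X f g \<rho>h x =
     arg_min (\<lambda>y. f y + ereal (\<rho>h / 2 * (norm (y - x))\<^sup>2)) (\<lambda>y. y \<in> X \<and> g y \<le> 0)"

end

theory Submission
  imports Defs
begin

text \<open>
  Let \<open>\<phi>(x)\<close> be the optimal value of the proximal subproblem at \<open>x\<close>. Projected steps decrease \<open>\<phi>\<close>
  by \<open>\<rho>h * \<eta> * (\<xi> \<bullet> (x - p x))\<close> up to a second-order term, and \<open>\<phi>\<close> varies by at most \<open>\<rho>h * D\<^sup>2 / 2\<close>.
  On \<open>f\<close>-steps the expected inner product is at least \<open>(\<rho>h - \<rho>) * (norm (p x - x))\<^sup>2\<close> minus
  \<open>Lam\<close> times the infeasibility, on \<open>g\<close>-steps it is at least the constraint value. Summing up, too large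
  a proximal residual on \<open>I\<close>, or an empty \<open>I\<close>, contradicts the bounded decrease as soon as three
  random quantities are controlled: the mini-batch errors, the sum of squared gradients and the
  martingale noise. Each is controlled by an exponential moment of a product over the iterations and
  Markov's inequality.
\<close>

section \<open>The proximal map and the envelope\<close>

text \<open>The oracles are not assumed measurable in the query point, so the conditional mean of a
  subgradient cannot be subtracted from the noise. Subtracted instead is \<open>drift\<close>, a
  lower bound built from the continuous maps \<open>g\<close> and \<open>p\<close>; the noise then
  becomes a supermartingale difference, and only positive multiples of it are exponentiated. The
  selected subgradient can be treated like a fixed one because, given the iterate, it is independent
  of the mini-batch that selects it. The target level is A = \<epsilon>^2 (\<rho>h - \<rho>) / (1 +
  Lam): for a tolerance at most A, an f-step with residual at least \<epsilon> and a g-step both add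
  at least \<eta> (tol - (1 + Lam) r) to the weighted drift, where r bounds the mini-batch error.
  Each case of the theorem only has to show that these gains exceed D^2 / 2 plus half the weighted
  squares plus the noise. The argument controls the mean of the squared residuals on
  \<open>I\<close>; the mean residual follows by Young's inequality.\<close>

locale constrained_prox =
  fixes X :: "'a::euclidean_space set" and f g :: "'a \<Rightarrow> real" and p :: "'a \<Rightarrow> 'a"
    and M D \<rho> \<rho>h Lam :: real and x_feas :: 'a
  assumes closed: "closed X" and convex: "convex X"
    and subF: "x' \<in> X \<Longrightarrow> \<exists>\<zeta>. norm \<zeta> \<le> M \<and>
      (\<forall>x\<in>X. f x \<ge> f x' + \<zeta> \<bullet> (x - x') - \<rho> / 2 * (norm (x - x'))\<^sup>2)"
    and subG: "x' \<in> X \<Longrightarrow> \<exists>\<zeta>. \<forall>x\<in>X. g x \<ge> g x' + \<zeta> \<bullet> (x - x')"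
    and rho: "0 \<le> \<rho>" "\<rho> < \<rho>h"
    and feas: "x_feas \<in> X" "g x_feas < 0"
    and M: "M > 0" and D: "D > 0"
    and diam: "x \<in> X \<Longrightarrow> x' \<in> X \<Longrightarrow> norm (x - x') \<le> D"
    and Lam: "Lam = (M * D + \<rho>h * D\<^sup>2) / (- g x_feas)"
    and p_mem: "x \<in> X \<Longrightarrow> p x \<in> X" and p_feas: "x \<in> X \<Longrightarrow> g (p x) \<le> 0"
    and p_min: "x \<in> X \<Longrightarrow> y \<in> X \<Longrightarrow> g y \<le> 0 \<Longrightarrow>
      f (p x) + \<rho>h / 2 * (norm (p x - x))\<^sup>2 \<le> f y + \<rho>h / 2 * (norm (y - x))\<^sup>2"
begin

section \<open>Strong convexity of the proximal objective and regularity of its minimiser\<close>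

definition obj :: "'a \<Rightarrow> 'a \<Rightarrow> real" where
  "obj x y = f y + \<rho>h / 2 * (norm (y - x))\<^sup>2"

lemma Lam_pos: "Lam > 0"
  unfolding Lam using feas rho M D by (intro divide_pos_pos add_pos_pos mult_pos_pos) auto

lemma convex_comb_mem: "y \<in> X \<Longrightarrow> y' \<in> X \<Longrightarrow> 0 \<le> s \<Longrightarrow> s \<le> 1 \<Longrightarrow> (1 - s) *\<^sub>R y + s *\<^sub>R y' \<in> X"
  using convex by (simp add: convex_alt)

lemma norm_convex_comb:
  fixes y y' x :: 'a
  shows "(norm ((1 - s) *\<^sub>R y + s *\<^sub>R y' - x))\<^sup>2 =
    (1 - s) * (norm (y - x))\<^sup>2 + s * (norm (y' - x))\<^sup>2 - s * (1 - s) * (norm (y - y'))\<^sup>2"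
  unfolding power2_norm_eq_inner
  by (simp add: inner_diff_left inner_diff_right inner_add_left inner_add_right inner_commute)
     (simp add: algebra_simps)

text \<open>The subgradient inequality at the intermediate point, tested at both endpoints with
  weights \<open>1 - s\<close> and \<open>s\<close>, loses its linear terms.\<close>

lemma g_convex:
  assumes "y \<in> X" "y' \<in> X" "0 \<le> s" "s \<le> 1"
  shows "g ((1 - s) *\<^sub>R y + s *\<^sub>R y') \<le> (1 - s) * g y + s * g y'"
proof -
  let ?z = "(1 - s) *\<^sub>R y + s *\<^sub>R y'"
  obtain \<zeta> where z: "\<forall>x\<in>X. g x \<ge> g ?z + \<zeta> \<bullet> (x - ?z)"
    using subG[OF convex_comb_mem[OF assms]] by blast
  have "(1 - s) * g y \<ge> (1 - s) * (g ?z + \<zeta> \<bullet> (y - ?z))"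
       "s * g y' \<ge> s * (g ?z + \<zeta> \<bullet> (y' - ?z))"
    using z assms by (auto intro!: mult_left_mono)
  moreover have "(1 - s) * (g ?z + \<zeta> \<bullet> (y - ?z)) + s * (g ?z + \<zeta> \<bullet> (y' - ?z)) = g ?z"
    by (simp add: algebra_simps inner_diff_right inner_add_right)
  ultimately show ?thesis by linarith
qed

text \<open>The argument used for \<open>g\<close> costs the modulus \<open>\<rho>\<close> for a
  weakly convex \<open>f\<close>; the quadratic term supplies \<open>\<rho>h\<close> by
  \<open>norm_convex_comb\<close>, and the difference is the modulus that remains.\<close>

lemma obj_strongly_convex:
  assumes "y \<in> X" "y' \<in> X" "0 \<le> s" "s \<le> 1"
  shows "obj x ((1 - s) *\<^sub>R y + s *\<^sub>R y') \<le>
    (1 - s) * obj x y + s * obj x y' - (\<rho>h - \<rho>) / 2 * (s * (1 - s) * (norm (y - y'))\<^sup>2)"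
proof -
  let ?z = "(1 - s) *\<^sub>R y + s *\<^sub>R y'"
  obtain \<zeta> where z: "\<forall>x\<in>X. f x \<ge> f ?z + \<zeta> \<bullet> (x - ?z) - \<rho> / 2 * (norm (x - ?z))\<^sup>2"
    using subF[OF convex_comb_mem[OF assms]] by blast
  have "y - ?z = s *\<^sub>R (y - y')" "y' - ?z = (1 - s) *\<^sub>R (y' - y)"
    by (simp_all add: algebra_simps)
  then have n: "(norm (y - ?z))\<^sup>2 = s\<^sup>2 * (norm (y - y'))\<^sup>2"
       "(norm (y' - ?z))\<^sup>2 = (1 - s)\<^sup>2 * (norm (y - y'))\<^sup>2"
    by (simp_all add: power_mult_distrib norm_minus_commute)
  have "(1 - s) * f y \<ge> (1 - s) * (f ?z + \<zeta> \<bullet> (y - ?z) - \<rho> / 2 * (s\<^sup>2 * (norm (y - y'))\<^sup>2))"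
       "s * f y' \<ge> s * (f ?z + \<zeta> \<bullet> (y' - ?z) - \<rho> / 2 * ((1 - s)\<^sup>2 * (norm (y - y'))\<^sup>2))"
    unfolding n[symmetric] using z assms by (auto intro!: mult_left_mono)
  moreover have "(1 - s) * (f ?z + \<zeta> \<bullet> (y - ?z) - \<rho> / 2 * (s\<^sup>2 * (norm (y - y'))\<^sup>2)) +
      s * (f ?z + \<zeta> \<bullet> (y' - ?z) - \<rho> / 2 * ((1 - s)\<^sup>2 * (norm (y - y'))\<^sup>2)) =
      f ?z - \<rho> / 2 * (s * (1 - s) * (norm (y - y'))\<^sup>2)"
    by (simp add: field_simps inner_diff_right inner_add_right power2_eq_square)
  ultimately have "f ?z \<le> (1 - s) * f y + s * f y' + \<rho> / 2 * (s * (1 - s) * (norm (y - y'))\<^sup>2)"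
    by linarith
  then show ?thesis
    unfolding obj_def norm_convex_comb by (simp add: field_simps)
qed

text \<open>Quadratic growth at a constrained minimiser: compare \<open>p x\<close> with the
  feasible point at the fraction \<open>s = 1 - r\<close> of the way to \<open>y\<close>, divide by
  \<open>s\<close>, and let \<open>r\<close> tend to 1.\<close>

lemma obj_growth:
  assumes x: "x \<in> X" and y: "y \<in> X" "g y \<le> 0"
  shows "obj x (p x) + (\<rho>h - \<rho>) / 2 * (norm (y - p x))\<^sup>2 \<le> obj x y"
proof -
  let ?b = "(\<rho>h - \<rho>) / 2 * (norm (y - p x))\<^sup>2"
  have "r * ?b \<le> obj x y - obj x (p x)" if r: "0 < r" "r < 1" for r
  proof -
    define s where "s = 1 - r"
    have s: "0 < s" "0 \<le> s" "s \<le> 1" using r by (auto simp: s_def)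
    let ?z = "(1 - s) *\<^sub>R p x + s *\<^sub>R y"
    have "g ?z \<le> (1 - s) * g (p x) + s * g y"
      using g_convex p_mem x y s by blast
    also have "\<dots> \<le> 0"
      using p_feas[OF x] y s by (intro add_nonpos_nonpos mult_nonneg_nonpos) auto
    finally have "obj x (p x) \<le> obj x ?z"
      unfolding obj_def using x y s p_mem by (intro p_min convex_comb_mem) auto
    also have "\<dots> \<le> (1 - s) * obj x (p x) + s * obj x y - (\<rho>h - \<rho>) / 2 * (s * (1 - s) * (norm (p x - y))\<^sup>2)"
      using x y s p_mem by (intro obj_strongly_convex) auto
    also have "\<dots> = obj x (p x) + s * (obj x y - obj x (p x) - (1 - s) * ?b)"
      by (simp add: field_simps norm_minus_commute)
    finally have "0 \<le> s * (obj x y - obj x (p x) - (1 - s) * ?b)" by simp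
    then have "0 \<le> obj x y - obj x (p x) - (1 - s) * ?b"
      using s by (simp add: zero_le_mult_iff)
    then show ?thesis by (simp add: s_def)
  qed
  then have "?b \<le> obj x y - obj x (p x)" by (rule field_le_mult_one_interval) auto
  then show ?thesis by simp
qed

text \<open>
  Moving from \<open>x\<close> towards the Slater point until feasibility replaces the Lagrange multiplier of the
  proximal problem; the constant \<open>Lam\<close> is exactly the price of this move.
\<close>

lemma gap_lower_bound:
  assumes x: "x \<in> X"
  shows "f x - f (p x) - \<rho> / 2 * (norm (p x - x))\<^sup>2
    \<ge> (\<rho>h - \<rho>) * (norm (p x - x))\<^sup>2 - Lam * max 0 (g x)"
proof -
  let ?\<gamma> = "max 0 (g x)" and ?G = "- g x_feas" and ?\<mu> = "\<rho>h - \<rho>"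
  \<comment> \<open>This weight makes the convex upper bound
    \<open>(1 - s) * ?\<gamma> + s * g x_feas\<close> vanish; it is 0 if \<open>x\<close> is already
    feasible.\<close>
  define s where "s = ?\<gamma> / (?\<gamma> + ?G)"
  have G: "?G > 0" using feas by simp
  then have "s \<le> ?\<gamma> / ?G"
    unfolding s_def by (intro divide_left_mono mult_pos_pos) auto
  moreover have "0 \<le> s" "s \<le> 1"
    using G by (auto simp: s_def divide_le_eq_1)
  ultimately have s: "0 \<le> s" "s \<le> 1" "s \<le> ?\<gamma> / ?G" by blast+
  let ?z = "(1 - s) *\<^sub>R x + s *\<^sub>R x_feas"
  have zX: "?z \<in> X" using x feas s by (intro convex_comb_mem) auto
  have "g ?z \<le> (1 - s) * g x + s * g x_feas"
    using g_convex x feas s by blast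
  also have "\<dots> \<le> (1 - s) * ?\<gamma> + s * g x_feas"
    using s by (intro add_right_mono mult_left_mono) auto
  also have "\<dots> = 0" using G by (simp add: s_def field_simps)
  finally have gz: "g ?z \<le> 0" .
  have "obj x (p x) + ?\<mu> / 2 * (norm (?z - p x))\<^sup>2 \<le> obj x ?z"
    using obj_growth x zX gz by blast
  also have "\<dots> \<le> (1 - s) * obj x x + s * obj x x_feas - ?\<mu> / 2 * (s * (1 - s) * (norm (x - x_feas))\<^sup>2)"
    using x feas s by (intro obj_strongly_convex) auto
  \<comment> \<open>Expanding the squared distance from \<open>?z\<close> to \<open>p x\<close>
    produces a negative term in \<open>norm (x - x_feas)\<close> that the strong convexity term
    cancels exactly.\<close>
  finally have 1: "obj x (p x) + ?\<mu> / 2 * ((1 - s) * (norm (x - p x))\<^sup>2 + s * (norm (x_feas - p x))\<^sup>2)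
     \<le> (1 - s) * obj x x + s * obj x x_feas"
    unfolding norm_convex_comb by (simp add: algebra_simps)
  obtain \<zeta> where \<zeta>: "norm \<zeta> \<le> M" "\<forall>y\<in>X. f y \<ge> f x_feas + \<zeta> \<bullet> (y - x_feas) - \<rho> / 2 * (norm (y - x_feas))\<^sup>2"
    using subF feas by blast
  have sq: "(norm (y - y'))\<^sup>2 \<le> D\<^sup>2" if "y \<in> X" "y' \<in> X" for y y'
    using diam[OF that] by (intro power_mono) auto
  have "\<bar>\<zeta> \<bullet> (x - x_feas)\<bar> \<le> M * D"
    using \<zeta>(1) diam[OF x feas(1)] by (intro order.trans[OF Cauchy_Schwarz_ineq2] mult_mono) (use M in auto)
  then have 2: "f x_feas - f x \<le> M * D + \<rho> / 2 * D\<^sup>2"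
    using \<zeta>(2) x mult_left_mono[OF sq[OF x feas(1)], of "\<rho> / 2"] rho by fastforce
  have "\<rho>h / 2 * (norm (x_feas - x))\<^sup>2 \<le> \<rho>h / 2 * D\<^sup>2"
    using sq[OF feas(1) x] rho by (intro mult_left_mono) auto
  then have "obj x x_feas - obj x x \<le> M * D + \<rho> / 2 * D\<^sup>2 + \<rho>h / 2 * D\<^sup>2"
    using 2 by (simp add: obj_def)
  moreover have "?\<mu> / 2 * (norm (x - p x))\<^sup>2 \<le> ?\<mu> / 2 * D\<^sup>2"
    using rho sq[OF x p_mem[OF x]] by (intro mult_left_mono) auto
  \<comment> \<open>The coefficients \<open>\<rho> / 2\<close>, \<open>\<rho>h / 2\<close> and
    \<open>(\<rho>h - \<rho>) / 2\<close> of \<open>D\<^sup>2\<close> add up to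
    \<open>\<rho>h\<close>; this is the numerator of \<open>Lam\<close>.\<close>
  ultimately have 3: "obj x x_feas - obj x x + ?\<mu> / 2 * (norm (x - p x))\<^sup>2 \<le> M * D + \<rho>h * D\<^sup>2"
    by (simp add: field_simps)
  have "0 \<le> ?\<mu> / 2 * (s * (norm (x_feas - p x))\<^sup>2)" using rho s by auto
  then have "obj x (p x) + ?\<mu> / 2 * (norm (x - p x))\<^sup>2 \<le>
      obj x x + s * (obj x x_feas - obj x x + ?\<mu> / 2 * (norm (x - p x))\<^sup>2)"
    using 1 by (simp add: field_simps)
  also have "\<dots> \<le> obj x x + s * (M * D + \<rho>h * D\<^sup>2)"
    using 3 s by (intro add_left_mono mult_left_mono) auto
  also have "s * (M * D + \<rho>h * D\<^sup>2) \<le> ?\<gamma> / ?G * (M * D + \<rho>h * D\<^sup>2)"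
    using s M D rho by (intro mult_right_mono) auto
  also have "\<dots> = Lam * ?\<gamma>" by (simp add: Lam)
  finally show ?thesis
    by (simp add: obj_def norm_minus_commute field_simps)
qed

text \<open>Each minimiser competes in the other problem, since both have the same feasible set.
  Adding the two growth inequalities cancels \<open>f\<close> and leaves an inner product. The
  resulting continuity of \<open>p\<close> is what makes the drift and the residual measurable along
  a run.\<close>

lemma p_lipschitz:
  assumes "x \<in> X" "x' \<in> X"
  shows "norm (p x - p x') \<le> \<rho>h / (\<rho>h - \<rho>) * norm (x - x')"
proof -
  let ?\<mu> = "\<rho>h - \<rho>" and ?n = "norm (p x - p x')"
  have "obj x (p x) + ?\<mu> / 2 * (norm (p x' - p x))\<^sup>2 \<le> obj x (p x')"
       "obj x' (p x') + ?\<mu> / 2 * (norm (p x - p x'))\<^sup>2 \<le> obj x' (p x)"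
    using assms p_mem p_feas by (blast intro!: obj_growth)+
  then have "?\<mu> * ?n\<^sup>2 \<le> obj x (p x') - obj x (p x) + obj x' (p x) - obj x' (p x')"
    by (simp add: norm_minus_commute field_simps)
  also have "\<dots> = \<rho>h * ((p x - p x') \<bullet> (x - x'))"
    unfolding obj_def power2_norm_eq_inner
    by (simp add: inner_diff_left inner_diff_right inner_commute) (simp add: field_simps)
  also have "\<dots> \<le> \<rho>h * (?n * norm (x - x'))"
    using rho by (intro mult_left_mono norm_cauchy_schwarz) auto
  finally have *: "?n * (?\<mu> * ?n) \<le> ?n * (\<rho>h * norm (x - x'))"
    by (simp add: power2_eq_square algebra_simps)
  have "?\<mu> * ?n \<le> \<rho>h * norm (x - x')"
  proof (cases "?n = 0")
    case False
    then have "?n > 0" by simp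
    with * show ?thesis by (simp only: mult_le_cancel_left_pos)
  qed (use rho in simp)
  then show ?thesis using rho by (simp add: field_simps)
qed

lemma continuous_on_p: "continuous_on X p"
proof (rule continuous_onI)
  fix x e :: "'a" and e' :: real
  assume x: "x \<in> X" "0 < e'"
  let ?L = "\<rho>h / (\<rho>h - \<rho>)"
  have L: "?L > 0" using rho by auto
  show "\<exists>d>0. \<forall>x'\<in>X. dist x' x < d \<longrightarrow> dist (p x') (p x) \<le> e'"
  proof (intro exI[of _ "e' / ?L"] conjI ballI impI)
    fix x' assume "x' \<in> X" "dist x' x < e' / ?L"
    then have "?L * norm (x' - x) \<le> e'" using L rho by (simp add: dist_norm field_simps)
    then show "dist (p x') (p x) \<le> e'"
      using p_lipschitz[OF \<open>x' \<in> X\<close> x(1)] by (simp add: dist_norm)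
  qed (use divide_pos_pos[OF x(2) L] in simp)
qed

text \<open>Lower bound on the expected inner product that is measurable in \<open>x\<close> without measurable oracles.\<close>

definition drift :: "bool \<Rightarrow> 'a \<Rightarrow> real" where
  "drift b x = (if b then (\<rho>h - \<rho>) * (norm (p x - x))\<^sup>2 - Lam * max 0 (g x) else g x)"

section \<open>Descent of the envelope and the deterministic bound for a run\<close>

lemma drift_le_f:
  assumes "x \<in> X" "\<forall>y\<in>X. f y \<ge> f x + \<zeta> \<bullet> (y - x) - \<rho> / 2 * (norm (y - x))\<^sup>2"
  shows "drift True x \<le> \<zeta> \<bullet> (x - p x)"
  using assms(2)[rule_format, OF p_mem[OF assms(1)]] gap_lower_bound[OF assms(1)]
  by (simp add: drift_def inner_diff_right)

lemma drift_le_g: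
  assumes "x \<in> X" "\<forall>y\<in>X. g y \<ge> g x + \<zeta> \<bullet> (y - x)"
  shows "drift False x \<le> \<zeta> \<bullet> (x - p x)"
  using assms(2)[rule_format, OF p_mem[OF assms(1)]] p_feas[OF assms(1)]
  by (simp add: drift_def inner_diff_right)

text \<open>The old point \<open>p x\<close> stays admissible in the problem at \<open>x'\<close>,
  and projecting onto \<open>X\<close> does not increase the distance to \<open>p x\<close>, which
  lies in \<open>X\<close>.\<close>

lemma envelope_descent:
  assumes "x \<in> X" "x' = closest_point X (x - \<eta> *\<^sub>R \<xi>)"
  shows "obj x' (p x') \<le> obj x (p x) + \<rho>h * (\<eta>\<^sup>2 * (norm \<xi>)\<^sup>2 / 2 - \<eta> * (\<xi> \<bullet> (x - p x)))"
proof -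
  have x': "x' \<in> X" using assms closest_point_in_set[OF closed] by auto
  have "dist (closest_point X (x - \<eta> *\<^sub>R \<xi>)) (closest_point X (p x)) \<le> dist (x - \<eta> *\<^sub>R \<xi>) (p x)"
    using convex closed assms by (intro closest_point_lipschitz) auto
  then have "norm (p x - x') \<le> norm (x - \<eta> *\<^sub>R \<xi> - p x)"
    using p_mem[OF assms(1)] by (simp add: assms(2) closest_point_self dist_norm norm_minus_commute)
  then have "(norm (p x - x'))\<^sup>2 \<le> (norm (x - \<eta> *\<^sub>R \<xi> - p x))\<^sup>2"
    by (intro power_mono) auto
  also have "\<dots> = (norm (p x - x))\<^sup>2 + 2 * (\<eta>\<^sup>2 * (norm \<xi>)\<^sup>2 / 2 - \<eta> * (\<xi> \<bullet> (x - p x)))"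
    unfolding power2_norm_eq_inner
    by (simp add: inner_diff_left inner_diff_right inner_commute) (simp add: algebra_simps power2_eq_square)
  finally have "\<rho>h / 2 * (norm (p x - x'))\<^sup>2 \<le>
      \<rho>h / 2 * ((norm (p x - x))\<^sup>2 + 2 * (\<eta>\<^sup>2 * (norm \<xi>)\<^sup>2 / 2 - \<eta> * (\<xi> \<bullet> (x - p x))))"
    using rho by (intro mult_left_mono) auto
  then have "obj x' (p x) \<le> obj x (p x) + \<rho>h * (\<eta>\<^sup>2 * (norm \<xi>)\<^sup>2 / 2 - \<eta> * (\<xi> \<bullet> (x - p x)))"
    by (simp add: obj_def algebra_simps)
  moreover have "obj x' (p x') \<le> obj x' (p x)"
    unfolding obj_def using p_min[OF x' p_mem p_feas] assms by auto
  ultimately show ?thesis by simp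
qed

text \<open>With \<open>p x'\<close> as competitor at \<open>x\<close> the values of
  \<open>f\<close> cancel, so the oscillation of the envelope involves only
  \<open>D\<close>.\<close>

lemma envelope_gap:
  assumes "x \<in> X" "x' \<in> X"
  shows "obj x (p x) - obj x' (p x') \<le> \<rho>h * (D\<^sup>2 / 2)"
proof -
  have "(norm (p x' - x))\<^sup>2 \<le> D\<^sup>2" using assms p_mem diam by (intro power_mono) auto
  then have "\<rho>h / 2 * (norm (p x' - x))\<^sup>2 \<le> \<rho>h / 2 * D\<^sup>2" using rho by (intro mult_left_mono) auto
  moreover have "0 \<le> \<rho>h / 2 * (norm (p x' - x'))\<^sup>2" using rho by simp
  moreover have "obj x (p x) \<le> obj x (p x')"
    unfolding obj_def using assms p_min p_mem p_feas by blast
  ultimately show ?thesis unfolding obj_def by linarith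
qed

lemma sum_inner_le:
  assumes x: "\<And>t. x t \<in> X" and step: "\<And>t. x (Suc t) = closest_point X (x t - \<eta> t *\<^sub>R \<xi> t)" and "S \<le> T"
  shows "(\<Sum>t=S..<T. \<eta> t * (\<xi> t \<bullet> (x t - p (x t)))) \<le> D\<^sup>2 / 2 + (\<Sum>t=S..<T. (\<eta> t)\<^sup>2 * (norm (\<xi> t))\<^sup>2) / 2"
proof -
  let ?d = "\<lambda>t. (\<eta> t)\<^sup>2 * (norm (\<xi> t))\<^sup>2 / 2 - \<eta> t * (\<xi> t \<bullet> (x t - p (x t)))"
  have "obj (x T) (p (x T)) \<le> obj (x S) (p (x S)) + \<rho>h * (\<Sum>t=S..<T. ?d t)"
    using \<open>S \<le> T\<close>
  proof (induction T rule: dec_induct)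
    case (step n)
    then show ?case using envelope_descent[OF x assms(2), of n] by (simp add: distrib_left)
  qed simp
  then have "\<rho>h * - (\<Sum>t=S..<T. ?d t) \<le> \<rho>h * (D\<^sup>2 / 2)"
    using envelope_gap[OF x x, of S T] by simp
  then have "- (\<Sum>t=S..<T. ?d t) \<le> D\<^sup>2 / 2"
    using rho by (simp only: mult_le_cancel_left_pos)
  then show ?thesis by (simp add: sum_subtractf sum_divide_distrib)
qed

text \<open>The deterministic core; \<open>r\<close> bounds the mini-batch error and
  \<open>P\<close> marks the f-steps. Every step contributes at least
  \<open>\<eta> t * (tol t - (1 + Lam) * r)\<close> to the weighted drift, up to the excess of the
  squared residual over \<open>\<epsilon>\<^sup>2\<close> on \<open>I\<close>. By
  \<open>budget\<close> these contributions exceed what the descent allows, so the total excess is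
  negative. The strict inequality also excludes an empty \<open>I\<close>.\<close>

lemma switching_bound:
  assumes x: "\<And>t. x t \<in> X" and step: "\<And>t. x (Suc t) = closest_point X (x t - \<eta> t *\<^sub>R \<xi> t)" and "S \<le> T"
    and \<eta>: "\<And>t. \<eta> t > 0" and r: "0 \<le> r"
    and A: "(1 + Lam) * A = \<epsilon>\<^sup>2 * (\<rho>h - \<rho>)"
    and tol: "\<And>t. S \<le> t \<Longrightarrow> t < T \<Longrightarrow> 0 \<le> tol t \<and> tol t \<le> A"
    and est: "\<And>t. S \<le> t \<Longrightarrow> t < T \<Longrightarrow> P t \<Longrightarrow> g (x t) \<le> tol t + r"
       "\<And>t. S \<le> t \<Longrightarrow> t < T \<Longrightarrow> \<not> P t \<Longrightarrow> g (x t) \<ge> tol t - r"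
    and noise: "(\<Sum>t=S..<T. \<eta> t * (drift (P t) (x t) - \<xi> t \<bullet> (x t - p (x t)))) \<le> N"
    and sq: "(\<Sum>t=S..<T. (\<eta> t)\<^sup>2 * (norm (\<xi> t))\<^sup>2) \<le> V"
    and budget: "D\<^sup>2 / 2 + V / 2 + N < (\<Sum>t=S..<T. \<eta> t * (tol t - (1 + Lam) * r))"
    and I: "I = {t. S \<le> t \<and> t < T \<and> P t}"
  shows "(\<Sum>t\<in>I. \<eta> t * (norm (p (x t) - x t))\<^sup>2) < \<epsilon>\<^sup>2 * (\<Sum>t\<in>I. \<eta> t)"
proof -
  let ?\<mu> = "\<rho>h - \<rho>"
  let ?e = "\<lambda>t. if P t then \<eta> t * (?\<mu> * (norm (p (x t) - x t))\<^sup>2 - ?\<mu> * \<epsilon>\<^sup>2) else 0"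
  have "?e t + \<eta> t * (tol t - (1 + Lam) * r) \<le> \<eta> t * drift (P t) (x t)" if t: "t \<in> {S..<T}" for t
  proof (cases "P t")
    case True
    have "Lam * max 0 (g (x t)) \<le> Lam * (tol t + r)"
      using est(1)[of t] tol[of t] t True r Lam_pos by (intro mult_left_mono) auto
    \<comment> \<open>Together these give \<open>(1 + Lam) * tol t \<le> (\<rho>h - \<rho>) *
      \<epsilon>\<^sup>2\<close>: the penalty \<open>- Lam * tol t\<close> of an f-step is at least
      the gain \<open>tol t\<close> of a g-step minus
      \<open>(\<rho>h - \<rho>) * \<epsilon>\<^sup>2\<close>.\<close>
    moreover have "tol t - A \<le> 0" "(tol t - A) * Lam \<le> 0"
      using tol[of t] t Lam_pos by (auto intro!: mult_nonpos_nonneg)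
    ultimately have "?\<mu> * (norm (p (x t) - x t))\<^sup>2 - ?\<mu> * \<epsilon>\<^sup>2 + (tol t - (1 + Lam) * r) \<le> drift (P t) (x t)"
      using True A r by (simp add: drift_def algebra_simps)
    from mult_left_mono[OF this, of "\<eta> t"] show ?thesis
      using \<eta>[of t] True by (simp add: distrib_left)
  next
    case False
    have "tol t - (1 + Lam) * r \<le> g (x t)"
      using est(2)[of t] t False mult_nonneg_nonneg[OF less_imp_le[OF Lam_pos] r] by (simp add: algebra_simps)
    then show ?thesis using \<eta>[of t] False by (simp add: drift_def)
  qed
  then have "(\<Sum>t=S..<T. ?e t + \<eta> t * (tol t - (1 + Lam) * r)) \<le> (\<Sum>t=S..<T. \<eta> t * drift (P t) (x t))"
    by (rule sum_mono)
  moreover have "(\<Sum>t=S..<T. \<eta> t * drift (P t) (x t)) \<le> D\<^sup>2 / 2 + V / 2 + N"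
    using noise sq sum_inner_le[of x \<eta> \<xi>, OF x step \<open>S \<le> T\<close>] by (simp add: right_diff_distrib sum_subtractf)
  ultimately have "(\<Sum>t=S..<T. ?e t) < 0" using budget by (simp add: sum.distrib)
  also have "(\<Sum>t=S..<T. ?e t) = (\<Sum>t\<in>I. \<eta> t * (?\<mu> * (norm (p (x t) - x t))\<^sup>2 - ?\<mu> * \<epsilon>\<^sup>2))"
    unfolding I by (intro sum.mono_neutral_cong_right) auto
  also have "\<dots> = ?\<mu> * ((\<Sum>t\<in>I. \<eta> t * (norm (p (x t) - x t))\<^sup>2) - \<epsilon>\<^sup>2 * (\<Sum>t\<in>I. \<eta> t))"
    by (simp add: sum_distrib_left sum_distrib_right right_diff_distrib sum_subtractf mult_ac)
  finally show ?thesis using rho by (simp add: mult_less_0_iff)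
qed

end

section \<open>Sub-Gaussian moments and conditional laws\<close>

text \<open>For \<open>x > 1\<close> the square dominates. Otherwise
  \<open>exp x \<le> 1 + x + x\<^sup>2\<close>, which for negative \<open>x\<close> comes from
  \<open>exp x \<le> 1 / (1 - x)\<close> and
  \<open>(1 + x + x\<^sup>2) * (1 - x) = 1 - x^3 \<ge> 1\<close>.\<close>

lemma exp_le_add_exp_square: "exp x \<le> x + exp (x\<^sup>2)" for x :: real
proof (cases "x > 1")
  case True
  then have "exp x \<le> exp (x\<^sup>2)" by (simp add: power2_eq_square)
  with True show ?thesis by linarith
next
  case False
  have "exp x \<le> 1 + x + x\<^sup>2"
  proof (cases "0 \<le> x")
    case True
    with False show ?thesis by (intro exp_bound) auto
  next
    case neg: False
    have "exp x = 1 / exp (- x)" by (simp add: exp_minus inverse_eq_divide)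
    also have "\<dots> \<le> 1 / (1 - x)"
      using exp_ge_add_one_self[of "- x"] neg by (intro divide_left_mono mult_pos_pos) auto
    also have "\<dots> \<le> 1 + x + x\<^sup>2"
    proof -
      have "1 \<le> (1 + x + x\<^sup>2) * (1 - x)"
        using neg mult_nonpos_nonneg[of x "x * x"] by (simp add: algebra_simps power2_eq_square)
      then show ?thesis using neg by (simp add: pos_divide_le_eq)
    qed
    finally show ?thesis .
  qed
  then show ?thesis using exp_ge_add_one_self[of "x\<^sup>2"] by linarith
qed

text \<open>Convexity of exp between 0 and \<open>q - 1\<close>. A pointwise substitute for Jensen's
  inequality: it is affine in \<open>exp q\<close>, so an exponential moment of at most e integrates
  to exactly \<open>exp c\<close>.\<close>

lemma exp_scale_le:
  fixes c q :: real
  assumes "0 \<le> c" "c \<le> 1"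
  shows "exp (c * q) \<le> exp c * (1 - c + c * exp (q - 1))"
proof -
  have "exp ((1 - c) *\<^sub>R 0 + c *\<^sub>R (q - 1)) \<le> (1 - c) * exp 0 + c * exp (q - 1)"
    using assms by (intro convex_onD[OF exp_convex]) auto
  then have "exp c * exp (c * (q - 1)) \<le> exp c * (1 - c + c * exp (q - 1))"
    by (intro mult_left_mono) auto
  then show ?thesis by (simp add: exp_add[symmetric] algebra_simps)
qed

section \<open>Exponential moments and the tail bounds they imply\<close>

context prob_space
begin

lemma nn_integral_exp_scale_le:
  assumes [measurable]: "q \<in> borel_measurable M"
    and q: "(\<integral>\<^sup>+x. ennreal (exp (q x)) \<partial>M) \<le> ennreal (exp 1)"
    and c: "0 \<le> c" "c \<le> 1"
  shows "(\<integral>\<^sup>+x. ennreal (exp (c * q x)) \<partial>M) \<le> ennreal (exp c)"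
proof -
  have "(\<integral>\<^sup>+x. ennreal (exp (c * q x)) \<partial>M) \<le>
      (\<integral>\<^sup>+x. ennreal (exp c * (1 - c)) + ennreal (exp c * c / exp 1) * ennreal (exp (q x)) \<partial>M)"
  proof (intro nn_integral_mono)
    fix x
    have "exp (c * q x) \<le> exp c * (1 - c) + exp c * c / exp 1 * exp (q x)"
      using exp_scale_le[OF c, of "q x"] by (simp add: exp_diff algebra_simps)
    then show "ennreal (exp (c * q x)) \<le> ennreal (exp c * (1 - c)) + ennreal (exp c * c / exp 1) * ennreal (exp (q x))"
      using c by (simp flip: ennreal_plus ennreal_mult)
  qed
  also have "\<dots> = ennreal (exp c * (1 - c)) + ennreal (exp c * c / exp 1) * (\<integral>\<^sup>+x. ennreal (exp (q x)) \<partial>M)"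
    by (simp add: nn_integral_add nn_integral_cmult emeasure_space_1)
  also have "\<dots> \<le> ennreal (exp c * (1 - c)) + ennreal (exp c * c / exp 1) * ennreal (exp 1)"
    using q by (intro add_left_mono mult_left_mono) auto
  also have "\<dots> = ennreal (exp c)"
    using c by (simp flip: ennreal_plus ennreal_mult) (simp add: algebra_simps)
  finally show ?thesis .
qed

text \<open>The mean of \<open>Y\<close> is removed by \<open>exp x \<le> x + exp (x\<^sup>2)\<close>.\<close>

lemma subgaussian_mgf:
  assumes Y: "integrable M Y" "expectation Y = 0" and s: "s > 0"
    and q: "(\<integral>\<^sup>+x. ennreal (exp ((Y x)\<^sup>2 / s\<^sup>2)) \<partial>M) \<le> ennreal (exp 1)"
  shows "(\<integral>\<^sup>+x. ennreal (exp (\<theta> * Y x)) \<partial>M) \<le> ennreal (exp (\<theta>\<^sup>2 * s\<^sup>2))"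
proof -
  have [measurable]: "Y \<in> borel_measurable M" using Y by auto
  let ?q = "\<lambda>x. (Y x)\<^sup>2 / s\<^sup>2" and ?c = "\<theta>\<^sup>2 * s\<^sup>2"
  show ?thesis
  \<comment> \<open>Up to \<open>?c = 1\<close> the square moment can be scaled by
    \<open>?c\<close>. Beyond that, Young's inequality splits \<open>\<theta> * Y x\<close> into
    \<open>?c / 2\<close> and half of \<open>?q x\<close>; the second part costs
    \<open>exp (1 / 2)\<close>, which is absorbed since \<open>?c > 1\<close>.\<close>
  proof (cases "?c \<le> 1")
    case True
    have le: "(\<integral>\<^sup>+x. ennreal (exp (?c * ?q x)) \<partial>M) \<le> ennreal (exp ?c)"
      using True q by (intro nn_integral_exp_scale_le) auto
    have "integrable M (\<lambda>x. exp (?c * ?q x))"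
      using le by (intro integrableI_bounded) (auto simp: less_top[symmetric] top_unique)
    note int = this Y(1)
    have le2: "expectation (\<lambda>x. exp (?c * ?q x)) \<le> exp ?c"
      using le by (subst (asm) nn_integral_eq_integral[OF int(1)]) (auto simp: ennreal_le_iff)
    have "exp (\<theta> * Y x) \<le> \<theta> * Y x + exp (?c * ?q x)" for x
      using exp_le_add_exp_square[of "\<theta> * Y x"] s by (simp add: power_mult_distrib)
    then have "(\<integral>\<^sup>+x. ennreal (exp (\<theta> * Y x)) \<partial>M) \<le> (\<integral>\<^sup>+x. ennreal (\<theta> * Y x + exp (?c * ?q x)) \<partial>M)"
      by (intro nn_integral_mono ennreal_leI)
    also have "\<dots> = ennreal (expectation (\<lambda>x. \<theta> * Y x + exp (?c * ?q x)))"
    proof (intro nn_integral_eq_integral AE_I2)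
      fix x show "0 \<le> \<theta> * Y x + exp (?c * ?q x)"
        using \<open>exp (\<theta> * Y x) \<le> \<theta> * Y x + exp (?c * ?q x)\<close> exp_ge_zero[of "\<theta> * Y x"] by linarith
    qed (use int in auto)
    also have "expectation (\<lambda>x. \<theta> * Y x + exp (?c * ?q x)) = expectation (\<lambda>x. exp (?c * ?q x))"
      using int Y by (subst Bochner_Integration.integral_add) auto
    finally show ?thesis using le2 by (meson ennreal_leI order_trans)
  next
    case False
    have "exp (\<theta> * Y x) \<le> exp (?c / 2) * exp (1 / 2 * ?q x)" for x
    proof -
      have "0 \<le> (\<theta> * s - Y x / s)\<^sup>2" by simp
      then have "2 * (\<theta> * Y x) \<le> ?c + ?q x"
        using s by (simp add: power2_diff power_mult_distrib power_divide)
      then show ?thesis by (simp flip: exp_add)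
    qed
    then have "(\<integral>\<^sup>+x. ennreal (exp (\<theta> * Y x)) \<partial>M) \<le> (\<integral>\<^sup>+x. ennreal (exp (?c / 2)) * ennreal (exp (1 / 2 * ?q x)) \<partial>M)"
      by (intro nn_integral_mono) (auto simp flip: ennreal_mult)
    also have "\<dots> = ennreal (exp (?c / 2)) * (\<integral>\<^sup>+x. ennreal (exp (1 / 2 * ?q x)) \<partial>M)"
      by (intro nn_integral_cmult) auto
    also have "\<dots> \<le> ennreal (exp (?c / 2)) * ennreal (exp (1 / 2))"
      using q by (intro mult_left_mono nn_integral_exp_scale_le) auto
    also have "\<dots> \<le> ennreal (exp ?c)"
      using False by (auto simp flip: ennreal_mult exp_add intro!: ennreal_leI)
    finally show ?thesis .
  qed
qed

text \<open>The scale \<open>2 * K * D\<close> arises because the centred variable is at most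
  \<open>(K + norm (\<xi> x)) * D\<close>. Its square divided by \<open>(2 * K * D)\<^sup>2\<close>
  is at most 1/2 plus half of the normalised squared norm, and each half accounts for a factor
  \<open>exp (1 / 2)\<close>.\<close>

lemma vector_noise_mgf:
  fixes \<xi> :: "'a \<Rightarrow> 'b::euclidean_space"
  assumes \<xi>: "integrable M \<xi>" and m: "norm (expectation \<xi>) \<le> K" and K: "K > 0"
    and q: "(\<integral>\<^sup>+x. ennreal (exp ((norm (\<xi> x))\<^sup>2 / K\<^sup>2)) \<partial>M) \<le> ennreal (exp 1)"
    and v: "norm v \<le> D" and D: "D > 0"
  shows "(\<integral>\<^sup>+x. ennreal (exp (\<theta> * ((expectation \<xi> - \<xi> x) \<bullet> v))) \<partial>M) \<le> ennreal (exp (\<theta>\<^sup>2 * (2 * K * D)\<^sup>2))"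
proof (rule subgaussian_mgf)
  have [measurable]: "\<xi> \<in> borel_measurable M" using \<xi> by auto
  let ?Y = "\<lambda>x. (expectation \<xi> - \<xi> x) \<bullet> v"
  show "integrable M ?Y" using \<xi> by auto
  show "expectation ?Y = 0"
    using \<xi> by (simp add: prob_space)
  have half: "(\<integral>\<^sup>+x. ennreal (exp (1 / 2 * ((norm (\<xi> x))\<^sup>2 / K\<^sup>2))) \<partial>M) \<le> ennreal (exp (1 / 2))"
    using q by (intro nn_integral_exp_scale_le) auto
  have "exp ((?Y x)\<^sup>2 / (2 * K * D)\<^sup>2) \<le> exp (1 / 2) * exp (1 / 2 * ((norm (\<xi> x))\<^sup>2 / K\<^sup>2))" for x
  proof -
    have "\<bar>?Y x\<bar> \<le> norm (expectation \<xi> - \<xi> x) * norm v" by (rule Cauchy_Schwarz_ineq2)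
    also have "\<dots> \<le> (K + norm (\<xi> x)) * D"
      using norm_triangle_ineq4[of "expectation \<xi>" "\<xi> x"] m v K by (intro mult_mono) auto
    finally have "(?Y x)\<^sup>2 \<le> ((K + norm (\<xi> x)) * D)\<^sup>2"
      using K D by (intro abs_le_square_iff[THEN iffD1]) (auto simp: abs_mult)
    also have "\<dots> \<le> (2 * K\<^sup>2 + 2 * (norm (\<xi> x))\<^sup>2) * D\<^sup>2"
      using sum_squares_bound[of K "norm (\<xi> x)"]
      by (auto simp: power_mult_distrib power2_sum intro!: mult_right_mono)
    finally have "(?Y x)\<^sup>2 / (2 * K * D)\<^sup>2 \<le> (2 * K\<^sup>2 + 2 * (norm (\<xi> x))\<^sup>2) * D\<^sup>2 / (2 * K * D)\<^sup>2"
      by (intro divide_right_mono) auto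
    also have "\<dots> = 1 / 2 + 1 / 2 * ((norm (\<xi> x))\<^sup>2 / K\<^sup>2)"
      using K D by (simp add: field_simps power_mult_distrib)
    finally show ?thesis by (simp flip: exp_add)
  qed
  then have "(\<integral>\<^sup>+x. ennreal (exp ((?Y x)\<^sup>2 / (2 * K * D)\<^sup>2)) \<partial>M) \<le>
     (\<integral>\<^sup>+x. ennreal (exp (1 / 2)) * ennreal (exp (1 / 2 * ((norm (\<xi> x))\<^sup>2 / K\<^sup>2))) \<partial>M)"
    by (intro nn_integral_mono) (auto simp flip: ennreal_mult)
  also have "\<dots> = ennreal (exp (1 / 2)) * (\<integral>\<^sup>+x. ennreal (exp (1 / 2 * ((norm (\<xi> x))\<^sup>2 / K\<^sup>2))) \<partial>M)"
    by (intro nn_integral_cmult) auto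
  also have "\<dots> \<le> ennreal (exp (1 / 2)) * ennreal (exp (1 / 2))"
    using half by (intro mult_left_mono) auto
  also have "\<dots> = ennreal (exp 1)" by (simp flip: ennreal_mult exp_add)
  finally show "(\<integral>\<^sup>+x. ennreal (exp ((?Y x)\<^sup>2 / (2 * K * D)\<^sup>2)) \<partial>M) \<le> ennreal (exp 1)" .
qed (use K D in auto)

lemma chernoff:
  assumes [measurable]: "Y \<in> borel_measurable M"
    and Y: "(\<integral>\<^sup>+x. ennreal (exp (Y x)) \<partial>M) \<le> ennreal (exp a)"
  shows "emeasure M {x \<in> space M. a + u < Y x} \<le> ennreal (exp (- u))"
proof -
  have "emeasure M {x \<in> space M. a + u < Y x} \<le> emeasure M {x \<in> space M. 1 \<le> ennreal (exp (- a - u)) * ennreal (exp (Y x))}"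
    by (intro emeasure_mono) (auto simp flip: ennreal_mult exp_add)
  also have "\<dots> \<le> ennreal (exp (- a - u)) * (\<integral>\<^sup>+x. ennreal (exp (Y x)) * indicator (space M) x \<partial>M)"
    by (intro nn_integral_Markov_inequality) auto
  also have "\<dots> \<le> ennreal (exp (- a - u)) * ennreal (exp a)"
    using Y by (intro mult_left_mono) (auto simp: nn_integral_cong[of M "\<lambda>x. _ x * indicator (space M) x"])
  also have "\<dots> = ennreal (exp (- u))" by (simp flip: ennreal_mult exp_add)
  finally show ?thesis .
qed

text \<open>The choice \<open>\<theta> = 2 l / u\<close> does not require \<open>v > 0\<close>, so exact oracles need no separate treatment.\<close>

lemma subgaussian_tail:
  assumes [measurable]: "Y \<in> borel_measurable M"
    and Y: "\<And>\<theta>. \<theta> > 0 \<Longrightarrow> (\<integral>\<^sup>+x. ennreal (exp (\<theta> * Y x)) \<partial>M) \<le> ennreal (exp (\<theta>\<^sup>2 * v))"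
    and u: "u > 0" "l > 0" "4 * v * l \<le> u\<^sup>2"
  shows "emeasure M {x \<in> space M. u < Y x} \<le> ennreal (exp (- l))"
proof -
  define \<theta> where "\<theta> = 2 * l / u"
  have \<theta>: "\<theta> > 0" using u by (simp add: \<theta>_def)
  have "\<theta>\<^sup>2 * v \<le> l"
  proof -
    have "\<theta>\<^sup>2 * v = l * (4 * v * l) / u\<^sup>2" by (simp add: \<theta>_def power2_eq_square)
    also have "\<dots> \<le> l * u\<^sup>2 / u\<^sup>2" using u by (intro divide_right_mono mult_left_mono) auto
    finally show ?thesis using u by simp
  qed
  then have "\<theta>\<^sup>2 * v + l \<le> \<theta> * u" using u by (simp add: \<theta>_def)
  then have "emeasure M {x \<in> space M. u < Y x} \<le> emeasure M {x \<in> space M. \<theta>\<^sup>2 * v + l < \<theta> * Y x}"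
    using \<theta> by (intro emeasure_mono) (auto intro: le_less_trans)
  also have "\<dots> \<le> ennreal (exp (- l))"
    using Y \<theta> by (intro chernoff) auto
  finally show ?thesis .
qed

end

section \<open>Disintegration along laws that are known only almost surely\<close>

lemma completion_measurable_AE:
  assumes f: "f \<in> measurable (completion M) N" and ae: "AE x in completion M. f x = h x"
    and h: "\<And>x. x \<in> space M \<Longrightarrow> h x \<in> space N"
  shows "h \<in> measurable (completion M) N"
proof (rule measurableI)
  fix A assume A: "A \<in> sets N"
  show "h -` A \<inter> space (completion M) \<in> sets (completion M)"
  proof (rule completion.in_sets_AE)
    show "f -` A \<inter> space (completion M) \<in> sets (completion M)" using f A by (rule measurable_sets)
    show "AE x in completion M. x \<in> f -` A \<inter> space (completion M) \<longleftrightarrow> x \<in> h -` A \<inter> space (completion M)"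
      using ae by eventually_elim auto
  qed auto
qed (use h in simp)

text \<open>
  The kernel \<open>K\<close> is measurable only with respect to the completion, by the almost sure identity
  with the conditional expectations; this suffices for disintegrating the joint law.
\<close>

lemma nn_integral_cond_law:
  assumes "prob_space \<Omega>" and sub: "subalgebra \<Omega> F" and Z[measurable]: "Z \<in> measurable \<Omega> N"
    and K: "\<And>w. w \<in> space \<Omega> \<Longrightarrow> prob_space (K w)" "\<And>w. w \<in> space \<Omega> \<Longrightarrow> sets (K w) = sets N"
    and law: "\<And>A. A \<in> sets N \<Longrightarrow> AE w in \<Omega>.
      real_cond_exp \<Omega> F (indicator (Z -` A \<inter> space \<Omega>)) w = measure (K w) A"
    and \<phi>[measurable]: "\<phi> \<in> borel_measurable (F \<Otimes>\<^sub>M N)"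
  shows "(\<integral>\<^sup>+w. \<phi> (w, Z w) \<partial>\<Omega>) = (\<integral>\<^sup>+w. (\<integral>\<^sup>+z. \<phi> (w, z) \<partial>K w) \<partial>\<Omega>)"
proof -
  interpret prob_space \<Omega> by fact
  interpret sigma_finite_subalgebra \<Omega> F
    using sub by (intro finite_measure_subalgebra_is_sigma_finite finite_measure_subalgebra.intro
        finite_measure_subalgebra_axioms.intro finite_measure_axioms)
  let ?C = "completion \<Omega>"
  have spF: "space F = space \<Omega>" using sub by (simp add: subalgebra_def)
  have idF: "(\<lambda>w. w) \<in> measurable \<Omega> F"
    using sub by (auto simp: subalgebra_def measurable_def intro: sets.Int_space_eq1)
  have idC[measurable]: "(\<lambda>w. w) \<in> measurable ?C F"
    using idF by (rule measurable_completion)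
  have ZC[measurable]: "(\<lambda>w. (w, Z w)) \<in> measurable \<Omega> (F \<Otimes>\<^sub>M N)"
    using idF by measurable
  have KC[measurable]: "K \<in> measurable ?C (subprob_algebra N)"
  proof (rule measurable_subprob_algebra)
    fix A assume A: "A \<in> sets N"
    have "(\<lambda>w. ennreal (real_cond_exp \<Omega> F (indicator (Z -` A \<inter> space \<Omega>)) w)) \<in> borel_measurable ?C"
      by (intro measurable_completion) simp
    moreover have "AE w in ?C. ennreal (real_cond_exp \<Omega> F (indicator (Z -` A \<inter> space \<Omega>)) w) = emeasure (K w) A"
    proof (rule AE_completion)
      show "AE w in \<Omega>. ennreal (real_cond_exp \<Omega> F (indicator (Z -` A \<inter> space \<Omega>)) w) = emeasure (K w) A"
        using law[OF A] AE_space
      proof eventually_elim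
        case (elim w)
        interpret Kw: prob_space "K w" using K elim by auto
        show ?case using elim by (simp add: Kw.emeasure_eq_measure)
      qed
    qed
    ultimately show "(\<lambda>w. emeasure (K w) A) \<in> borel_measurable ?C"
      by (rule completion_measurable_AE) simp
  qed (use K prob_space_imp_subprob_space in auto)
  let ?L = "distr \<Omega> (F \<Otimes>\<^sub>M N) (\<lambda>w. (w, Z w))"
  let ?R = "?C \<bind> (\<lambda>w. distr (K w) (F \<Otimes>\<^sub>M N) (Pair w))"
  have neC: "space ?C \<noteq> {}" using not_empty by simp
  have R[measurable]: "(\<lambda>w. distr (K w) (F \<Otimes>\<^sub>M N) (Pair w)) \<in> measurable ?C (subprob_algebra (F \<Otimes>\<^sub>M N))"
    by (rule measurable_distr2[OF _ KC]) measurable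
  let ?E = "{a \<times> b | a b. a \<in> sets F \<and> b \<in> sets N}"
  \<comment> \<open>Rectangles \<open>a \<times> b\<close> with \<open>a\<close> in \<open>F\<close>
    form a generating pi-system. On them the equality is the defining property of the conditional
    expectation, integrated over \<open>a\<close>; only one \<open>b\<close> enters at a time, so
    the exceptional null set may depend on \<open>b\<close>.\<close>
  have "?L = ?R"
  proof (rule measure_eqI_generator_eq[OF Int_stable_pair_measure_generator[of F N], where A="\<lambda>_. space F \<times> space N" and \<Omega>="space F \<times> space N"])
    show "?E \<subseteq> Pow (space F \<times> space N)"
      using sets.space_closed[of F] sets.space_closed[of N] by auto
    show "sets ?L = sigma_sets (space F \<times> space N) ?E" by (simp add: sets_pair_measure)
    show "sets ?R = sigma_sets (space F \<times> space N) ?E"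
      using neC by (simp add: sets_bind[where N="F \<Otimes>\<^sub>M N"] sets_pair_measure)
    show "range (\<lambda>_. space F \<times> space N) \<subseteq> ?E" by auto
    show "(\<Union>i::nat. space F \<times> space N) = space F \<times> space N" by auto
    fix i :: nat show "emeasure ?L (space F \<times> space N) \<noteq> \<infinity>"
      by (simp add: emeasure_distr emeasure_eq_measure)
  next
    fix C assume "C \<in> ?E"
    then obtain a b where C: "C = a \<times> b" and a: "a \<in> sets F" and b[measurable]: "b \<in> sets N" by auto
    have a'[measurable]: "a \<in> sets \<Omega>" using a sub by (auto simp: subalgebra_def)
    have C'[measurable]: "C \<in> sets (F \<Otimes>\<^sub>M N)" using a C by simp
    let ?i = "indicator (Z -` b \<inter> space \<Omega>) :: _ \<Rightarrow> real"
    have int: "integrable \<Omega> ?i" by (simp add: emeasure_eq_measure less_top[symmetric])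
    have "emeasure ?L C = emeasure \<Omega> (a \<inter> (Z -` b \<inter> space \<Omega>))"
      using sets.sets_into_space[OF a'] C' by (subst emeasure_distr) (auto simp: C intro!: arg_cong[where f="emeasure \<Omega>"])
    also have "\<dots> = ennreal (\<integral>w\<in>a. ?i w \<partial>\<Omega>)"
      by (simp add: emeasure_eq_measure set_lebesgue_integral_def indicator_inter_arith[symmetric] Int_assoc[symmetric])
    also have "\<dots> = ennreal (\<integral>w\<in>a. real_cond_exp \<Omega> F ?i w \<partial>\<Omega>)"
      using real_cond_exp_intA[OF int a] by simp
    also have "\<dots> = (\<integral>\<^sup>+w. ennreal (indicator a w *\<^sub>R real_cond_exp \<Omega> F ?i w) \<partial>\<Omega>)"
      unfolding set_lebesgue_integral_def
    proof (intro nn_integral_eq_integral[symmetric])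
      show "AE w in \<Omega>. 0 \<le> indicat_real a w *\<^sub>R real_cond_exp \<Omega> F ?i w"
        using law[OF b] by eventually_elim simp
    qed (use integrable_mult_indicator[OF a' real_cond_exp_int(1)[OF int]] in simp)
    also have "\<dots> = (\<integral>\<^sup>+w. indicator a w * emeasure (K w) b \<partial>\<Omega>)"
    proof (rule nn_integral_cong_AE)
      show "AE w in \<Omega>. ennreal (indicator a w *\<^sub>R real_cond_exp \<Omega> F ?i w) = indicator a w * emeasure (K w) b"
        using law[OF b] AE_space
      proof eventually_elim
        case (elim w)
        interpret Kw: prob_space "K w" using K elim by auto
        show ?case using elim by (simp add: Kw.emeasure_eq_measure indicator_def)
      qed
    qed
    also have "\<dots> = (\<integral>\<^sup>+w. emeasure (distr (K w) (F \<Otimes>\<^sub>M N) (Pair w)) C \<partial>\<Omega>)"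
    proof (rule nn_integral_cong)
      fix w assume w: "w \<in> space \<Omega>"
      have "Pair w \<in> measurable (K w) (F \<Otimes>\<^sub>M N)"
        using w K(2)[OF w] spF by (subst measurable_cong_sets[OF K(2)[OF w] refl]) auto
      then have "emeasure (distr (K w) (F \<Otimes>\<^sub>M N) (Pair w)) C = emeasure (K w) (Pair w -` C \<inter> space (K w))"
        using C' by (rule emeasure_distr)
      also have "Pair w -` C \<inter> space (K w) = (if w \<in> a then b else {})"
        using sets.sets_into_space[OF b] sets_eq_imp_space_eq[OF K(2)[OF w]] by (auto simp: C)
      finally show "indicator a w * emeasure (K w) b = emeasure (distr (K w) (F \<Otimes>\<^sub>M N) (Pair w)) C"
        by (simp add: indicator_def)
    qed
    also have "\<dots> = emeasure ?R C"
      by (simp add: emeasure_bind[OF neC R C'] nn_integral_completion)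
    finally show "emeasure ?L C = emeasure ?R C" .
  qed
  have "(\<integral>\<^sup>+w. \<phi> (w, Z w) \<partial>\<Omega>) = (\<integral>\<^sup>+v. \<phi> v \<partial>?L)"
    by (simp add: nn_integral_distr)
  also have "\<dots> = (\<integral>\<^sup>+w. (\<integral>\<^sup>+v. \<phi> v \<partial>distr (K w) (F \<Otimes>\<^sub>M N) (Pair w)) \<partial>\<Omega>)"
    unfolding \<open>?L = ?R\<close> by (simp add: nn_integral_bind[OF \<phi> R] nn_integral_completion)
  also have "\<dots> = (\<integral>\<^sup>+w. (\<integral>\<^sup>+z. \<phi> (w, z) \<partial>K w) \<partial>\<Omega>)"
  proof (rule nn_integral_cong)
    fix w assume w: "w \<in> space \<Omega>"
    have "Pair w \<in> measurable (K w) (F \<Otimes>\<^sub>M N)"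
      using w K(2)[OF w] spF by (subst measurable_cong_sets[OF K(2)[OF w] refl]) auto
    then show "(\<integral>\<^sup>+v. \<phi> v \<partial>distr (K w) (F \<Otimes>\<^sub>M N) (Pair w)) = (\<integral>\<^sup>+z. \<phi> (w, z) \<partial>K w)"
      by (rule nn_integral_distr) (unfold measurable_distr_eq1, rule \<phi>)
  qed
  finally show ?thesis .
qed

section \<open>Concentration along a run\<close>

lemma outputs_law_prob_sets:
  assumes "prob_space (Q x)" "sets (Q x) = sets borel" "prob_space (Pf x)" "sets (Pf x) = sets borel"
    "prob_space (Pg x)" "sets (Pg x) = sets borel"
  shows "prob_space (outputs_law B Q Pf Pg x)" "sets (outputs_law B Q Pf Pg x) = sets (outputs_space B)"
proof -
  interpret f: prob_space "Pf x" by fact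
  interpret g: prob_space "Pg x" by fact
  interpret fg: pair_prob_space "Pf x" "Pg x" ..
  interpret q: prob_space "\<Pi>\<^sub>M i\<in>{..<B}. Q x" using assms(1) by (intro prob_space_PiM)
  interpret all: pair_prob_space "\<Pi>\<^sub>M i\<in>{..<B}. Q x" "Pf x \<Otimes>\<^sub>M Pg x" ..
  show "prob_space (outputs_law B Q Pf Pg x)"
    unfolding outputs_law_def by (rule all.prob_space_axioms)
  show "sets (outputs_law B Q Pf Pg x) = sets (outputs_space B)"
    unfolding outputs_law_def outputs_space_def
    using assms by (intro sets_pair_measure_cong sets_PiM_cong) auto
qed

text \<open>\<open>f_step\<close> at \<open>t\<close> reads only entry \<open>t\<close> of its
  sequence, so a constant sequence turns it into a predicate on a single triple. The same device is
  used in \<open>selected\<close>.\<close>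

lemma f_step_measurable:
  assumes [measurable]: "h \<in> measurable F (outputs_space B)"
  shows "Measurable.pred F (\<lambda>w. f_step B tol (\<lambda>_. h w) t)"
proof -
  have [measurable]: "(\<lambda>w. fst (h w)) \<in> measurable F (\<Pi>\<^sub>M i\<in>{..<B}. borel)"
    using assms unfolding outputs_space_def by measurable
  have "(\<lambda>w. fst (h w) i) \<in> borel_measurable F" if "i \<in> {..<B}" for i
    using that by measurable
  then have [measurable]: "(\<lambda>w. \<Sum>i<B. fst (h w) i) \<in> borel_measurable F"
    by (intro borel_measurable_sum)
  show ?thesis unfolding f_step_def by measurable
qed

definition selected :: "nat \<Rightarrow> (nat \<Rightarrow> real) \<Rightarrow> nat \<Rightarrow> 'a::euclidean_space outputs \<Rightarrow> 'a" where
  "selected B tol t z = (if f_step B tol (\<lambda>_. z) t then fst (snd z) else snd (snd z))"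

lemma selected_measurable:
  assumes [measurable]: "h \<in> measurable F (outputs_space B)"
  shows "(\<lambda>w. selected B tol t (h w)) \<in> borel_measurable F"
proof -
  note f_step_measurable[OF assms, measurable]
  have [measurable]: "(\<lambda>w. fst (snd (h w))) \<in> borel_measurable F" "(\<lambda>w. snd (snd (h w))) \<in> borel_measurable F"
    using assms unfolding outputs_space_def by measurable
  show ?thesis unfolding selected_def by measurable
qed

section \<open>The run as an adapted process\<close>

locale switching_process = prob_space \<Omega>
  for \<Omega> :: "'w measure" +
  fixes X :: "'a::euclidean_space set" and T B :: nat and tol \<eta> :: "nat \<Rightarrow> real" and x0 :: 'a
    and Q :: "'a \<Rightarrow> real measure" and Pf Pg :: "'a \<Rightarrow> 'a measure" and Z :: "nat \<Rightarrow> 'w \<Rightarrow> 'a outputs"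
  assumes closed: "closed X" and convex: "convex X" and B: "B > 0"
    and run: "switching_run \<Omega> X T B tol \<eta> x0 Q Pf Pg Z"
    and Q: "x \<in> X \<Longrightarrow> prob_space (Q x)" "x \<in> X \<Longrightarrow> sets (Q x) = sets borel"
    and Pf: "x \<in> X \<Longrightarrow> prob_space (Pf x)" "x \<in> X \<Longrightarrow> sets (Pf x) = sets borel"
    and Pg: "x \<in> X \<Longrightarrow> prob_space (Pg x)" "x \<in> X \<Longrightarrow> sets (Pg x) = sets borel"
begin

definition it :: "'w \<Rightarrow> nat \<Rightarrow> 'a" where "it w = iterate X B tol \<eta> x0 (\<lambda>s. Z s w)"

definition stp :: "'w \<Rightarrow> nat \<Rightarrow> bool" where "stp w = f_step B tol (\<lambda>s. Z s w)"

definition xi :: "'w \<Rightarrow> nat \<Rightarrow> 'a" where "xi w t = selected B tol t (Z t w)"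

abbreviation "law \<equiv> outputs_law B Q Pf Pg"

lemma stp_single: "stp w t \<longleftrightarrow> f_step B tol (\<lambda>_. Z t w) t"
  by (simp add: stp_def f_step_def)

lemma it_Suc: "it w (Suc t) = closest_point X (it w t - \<eta> t *\<^sub>R xi w t)"
  using stp_single[of w t] by (simp add: it_def xi_def selected_def stp_def)

lemma it_mem: "it w t \<in> X"
proof (cases t)
  case 0
  then show ?thesis using run by (simp add: it_def switching_run_def)
next
  case (Suc s)
  have "X \<noteq> {}" using run by (auto simp: switching_run_def)
  then show ?thesis using closest_point_in_set[OF closed] by (simp add: Suc it_Suc)
qed

lemma law: "x \<in> X \<Longrightarrow> prob_space (law x)" "x \<in> X \<Longrightarrow> sets (law x) = sets (outputs_space B)"
  using outputs_law_prob_sets[of Q x Pf Pg B] Q Pf Pg by simp_all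

lemma Z_measurable: "t < T \<Longrightarrow> Z t \<in> measurable \<Omega> (outputs_space B)"
  using run by (simp add: switching_run_def)

lemma past_vector_measurable:
  assumes "t \<le> T"
  shows "(\<lambda>w. \<lambda>s\<in>{..<t}. Z s w) \<in> measurable \<Omega> (\<Pi>\<^sub>M s\<in>{..<t}. outputs_space B)"
  by (rule measurable_restrict, rule Z_measurable) (use assms in simp)

lemma Z_past_measurable:
  assumes "s < t" "t \<le> T"
  shows "Z s \<in> measurable (past \<Omega> B Z t) (outputs_space B)"
proof -
  have "(\<lambda>w. \<lambda>s\<in>{..<t}. Z s w) \<in> measurable (past \<Omega> B Z t) (\<Pi>\<^sub>M s\<in>{..<t}. outputs_space B)"
    unfolding past_def
    by (rule measurable_vimage_algebra1, rule funcsetI, rule measurable_space[OF past_vector_measurable[OF assms(2)]])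
  from measurable_compose[OF this measurable_component_singleton[of s]] show ?thesis
    using assms by simp
qed

lemma subalgebra_past:
  assumes "t \<le> T"
  shows "subalgebra \<Omega> (past \<Omega> B Z t)"
proof -
  have "(\<lambda>w. \<lambda>s\<in>{..<t}. Z s w) \<in> space \<Omega> \<rightarrow> space (\<Pi>\<^sub>M s\<in>{..<t}. outputs_space B)"
    by (rule funcsetI, rule measurable_space[OF past_vector_measurable[OF assms]])
  from sets_vimage_algebra2[OF this] show ?thesis
    unfolding subalgebra_def past_def
    using measurable_sets[OF past_vector_measurable[OF assms]] by (auto simp only: space_vimage_algebra)
qed

text \<open>The sigma-algebra \<open>F\<close> is arbitrary because two are needed:
  \<open>past\<close>, for which this is adaptedness, and the whole space.\<close>

lemma it_measurable:
  assumes "\<And>s. s < t \<Longrightarrow> Z s \<in> measurable F (outputs_space B)"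
  shows "(\<lambda>w. it w t) \<in> borel_measurable F"
  using assms
proof (induction t)
  case 0
  then show ?case by (simp add: it_def)
next
  case (Suc t)
  have "X \<noteq> {}" using run by (auto simp: switching_run_def)
  then have [measurable]: "closest_point X \<in> borel_measurable borel"
    using closed convex by (intro borel_measurable_continuous_onI continuous_on_closest_point)
  have [measurable]: "(\<lambda>w. it w t) \<in> borel_measurable F"
    by (rule Suc.IH, rule Suc.prems) simp
  have [measurable]: "(\<lambda>w. xi w t) \<in> borel_measurable F"
    unfolding xi_def by (rule selected_measurable, rule Suc.prems) simp
  show ?case unfolding it_Suc by measurable
qed

lemma measurable_Om:
  assumes "t < T"
  shows it_Om: "(\<lambda>w. it w t) \<in> borel_measurable \<Omega>"
    and xi_Om: "(\<lambda>w. xi w t) \<in> borel_measurable \<Omega>"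
    and stp_Om: "Measurable.pred \<Omega> (\<lambda>w. stp w t)"
  unfolding xi_def stp_single
  using assms Z_measurable by (auto intro!: it_measurable selected_measurable f_step_measurable)

text \<open>The tower property behind all three tail bounds: the product before \<open>t\<close> is
  determined by the past and factors out, while the last factor is integrated against the law at the
  current iterate. The bound \<open>c s\<close> is uniform over \<open>X\<close>, so starting at
  \<open>S\<close> requires nothing about how the run reached its iterate there.\<close>

lemma nn_integral_prod_le:
  assumes H: "\<And>s. s < T \<Longrightarrow> H s \<in> borel_measurable (borel \<Otimes>\<^sub>M outputs_space B)"
    and le: "\<And>s x. S \<le> s \<Longrightarrow> s < T \<Longrightarrow> x \<in> X \<Longrightarrow> (\<integral>\<^sup>+z. H s (x, z) \<partial>law x) \<le> c s"
    and t: "S \<le> t" "t \<le> T"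
  shows "(\<integral>\<^sup>+w. (\<Prod>s=S..<t. H s (it w s, Z s w)) \<partial>\<Omega>) \<le> (\<Prod>s=S..<t. c s)"
  using t
proof (induction t rule: dec_induct)
  case base
  then show ?case by (simp add: emeasure_space_1)
next
  case (step t)
  let ?F = "past \<Omega> B Z t" and ?G = "\<lambda>w. \<Prod>s=S..<t. H s (it w s, Z s w)"
  have tT: "t < T" "t \<le> T" using step by auto
  note [measurable] = H[OF tT(1)]
  have it[measurable]: "(\<lambda>w. it w s) \<in> borel_measurable ?F" if "s \<le> t" for s
    using that tT by (intro it_measurable Z_past_measurable) auto
  have "(\<lambda>w. H s (it w s, Z s w)) \<in> borel_measurable ?F" if "s \<in> {S..<t}" for s
    using that tT by (intro measurable_compose[OF _ H] measurable_Pair it Z_past_measurable) auto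
  then have G[measurable]: "?G \<in> borel_measurable ?F" by (rule borel_measurable_prod_ennreal)
  have GO: "?G \<in> borel_measurable \<Omega>"
    using G subalgebra_past[OF tT(2)] by (rule measurable_from_subalg[rotated])
  have [measurable]: "(\<lambda>w. it w t) \<in> borel_measurable ?F" by (rule it) simp
  \<comment> \<open>The first component carries the past and the second the fresh output, which is
    the shape \<open>nn_integral_cond_law\<close> requires.\<close>
  let ?\<phi> = "\<lambda>v. ?G (fst v) * H t (it (fst v) t, snd v)"
  have "?\<phi> \<in> borel_measurable (?F \<Otimes>\<^sub>M outputs_space B)"
    by measurable
  then have "(\<integral>\<^sup>+w. ?\<phi> (w, Z t w) \<partial>\<Omega>) = (\<integral>\<^sup>+w. (\<integral>\<^sup>+z. ?\<phi> (w, z) \<partial>law (it w t)) \<partial>\<Omega>)"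
    using subalgebra_past[OF tT(2)] Z_measurable[OF tT(1)] it_mem law tT run
    by (intro nn_integral_cond_law[where N="outputs_space B" and F="?F"] prob_space_axioms)
       (simp_all add: switching_run_def it_def)
  also have "\<dots> \<le> (\<integral>\<^sup>+w. ?G w * c t \<partial>\<Omega>)"
  proof (intro nn_integral_mono)
    fix w
    have "Pair (it w t) \<in> measurable (law (it w t)) (borel \<Otimes>\<^sub>M outputs_space B)"
      by (subst measurable_cong_sets[OF law(2)[OF it_mem] refl]) auto
    then have "(\<lambda>z. H t (it w t, z)) \<in> borel_measurable (law (it w t))"
      by (rule measurable_compose) (use tT H in auto)
    then have "(\<integral>\<^sup>+z. ?\<phi> (w, z) \<partial>law (it w t)) = ?G w * (\<integral>\<^sup>+z. H t (it w t, z) \<partial>law (it w t))"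
      by (simp add: nn_integral_cmult)
    also have "\<dots> \<le> ?G w * c t" using step tT it_mem by (intro mult_left_mono le) auto
    finally show "(\<integral>\<^sup>+z. ?\<phi> (w, z) \<partial>law (it w t)) \<le> ?G w * c t" .
  qed
  also have "\<dots> = (\<integral>\<^sup>+w. ?G w \<partial>\<Omega>) * c t" by (rule nn_integral_multc[OF GO])
  also have "\<dots> \<le> (\<Prod>s=S..<t. c s) * c t" using step by (intro mult_right_mono) auto
  finally show ?case using step by (simp add: mult_ac)
qed

text \<open>Under \<open>law x\<close> the mini-batch is independent of both subgradients. Fixing it
  decides the branch, and the inner integral is then over \<open>Pf x\<close> or
  \<open>Pg x\<close>, so selection does not bias the subgradient.\<close>

lemma nn_integral_selected_le:
  assumes x: "x \<in> X" and [measurable]: "\<phi> \<in> borel_measurable borel" "\<psi> \<in> borel_measurable borel"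
    and f: "(\<integral>\<^sup>+\<xi>. \<phi> \<xi> \<partial>Pf x) \<le> c" and g: "(\<integral>\<^sup>+\<xi>. \<psi> \<xi> \<partial>Pg x) \<le> c"
  shows "(\<integral>\<^sup>+z. (if f_step B tol (\<lambda>_. z) t then \<phi> (selected B tol t z) else \<psi> (selected B tol t z)) \<partial>law x) \<le> c"
proof -
  let ?P = "\<Pi>\<^sub>M i\<in>{..<B}. Q x"
  let ?h = "\<lambda>z. if f_step B tol (\<lambda>_. z) t then \<phi> (selected B tol t z) else \<psi> (selected B tol t z)"
  interpret f: prob_space "Pf x" by (rule Pf[OF x])
  interpret g: prob_space "Pg x" by (rule Pg[OF x])
  interpret fg: pair_prob_space "Pf x" "Pg x" ..
  interpret q: prob_space ?P using Q[OF x] by (intro prob_space_PiM)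
  have "(\<lambda>z. z) \<in> measurable (law x) (outputs_space B)"
    using law[OF x] by (simp cong: measurable_cong_sets)
  note [measurable] = f_step_measurable[OF this] selected_measurable[OF this]
  have h: "?h \<in> borel_measurable (law x)" by measurable
  then have h': "?h \<in> borel_measurable (?P \<Otimes>\<^sub>M (Pf x \<Otimes>\<^sub>M Pg x))" by (simp add: outputs_law_def)
  have "(\<integral>\<^sup>+z. ?h z \<partial>law x) = (\<integral>\<^sup>+\<omega>. (\<integral>\<^sup>+y. ?h (\<omega>, y) \<partial>(Pf x \<Otimes>\<^sub>M Pg x)) \<partial>?P)"
    unfolding outputs_law_def using fg.nn_integral_fst[OF h'] by simp
  also have "\<dots> \<le> (\<integral>\<^sup>+\<omega>. c \<partial>?P)"
  proof (intro nn_integral_mono)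
    fix \<omega> assume "\<omega> \<in> space ?P"
    have \<phi>': "\<phi> \<in> borel_measurable (Pf x)" "\<psi> \<in> borel_measurable (Pg x)"
      using Pf[OF x] Pg[OF x] by (auto cong: measurable_cong_sets)
    show "(\<integral>\<^sup>+y. ?h (\<omega>, y) \<partial>(Pf x \<Otimes>\<^sub>M Pg x)) \<le> c"
    proof (cases "(\<Sum>i<B. \<omega> i) / real B \<le> tol t")
      case True
      then have "(\<integral>\<^sup>+y. ?h (\<omega>, y) \<partial>(Pf x \<Otimes>\<^sub>M Pg x)) = (\<integral>\<^sup>+y. \<phi> (fst y) \<partial>(Pf x \<Otimes>\<^sub>M Pg x))"
        by (simp add: f_step_def selected_def)
      also have "\<dots> = (\<integral>\<^sup>+a. (\<integral>\<^sup>+b. \<phi> (fst (a, b)) \<partial>Pg x) \<partial>Pf x)"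
        by (intro g.nn_integral_fst[symmetric] measurable_compose[OF measurable_fst \<phi>'(1)])
      finally show ?thesis using f by (simp add: g.emeasure_space_1)
    next
      case False
      then have "(\<integral>\<^sup>+y. ?h (\<omega>, y) \<partial>(Pf x \<Otimes>\<^sub>M Pg x)) = (\<integral>\<^sup>+y. \<psi> (snd y) \<partial>(Pf x \<Otimes>\<^sub>M Pg x))"
        by (simp add: f_step_def selected_def)
      also have "\<dots> = (\<integral>\<^sup>+a. (\<integral>\<^sup>+b. \<psi> (snd (a, b)) \<partial>Pg x) \<partial>Pf x)"
        by (intro g.nn_integral_fst[symmetric] measurable_compose[OF measurable_snd \<phi>'(2)])
      finally show ?thesis using g by (simp add: f.emeasure_space_1)
    qed
  qed
  also have "\<dots> = c" by (simp add: q.emeasure_space_1)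
  finally show ?thesis .
qed

section \<open>Tail bounds for the three random quantities\<close>

definition batch_mean :: "'a outputs \<Rightarrow> real" where
  "batch_mean z = (\<Sum>i<B. fst z i) / real B"

lemma stp_iff: "stp w t \<longleftrightarrow> batch_mean (Z t w) \<le> tol t"
  by (simp add: stp_def f_step_def batch_mean_def)

lemma batch_mean_measurable: "batch_mean \<in> borel_measurable (outputs_space B)"
proof -
  have [measurable]: "fst \<in> measurable (outputs_space B) (\<Pi>\<^sub>M i\<in>{..<B}. borel)"
    unfolding outputs_space_def by measurable
  have "(\<lambda>w. fst w i) \<in> borel_measurable (outputs_space B)" if "i \<in> {..<B}" for i
    using that by measurable
  then have [measurable]: "(\<lambda>w. \<Sum>i<B. fst w i) \<in> borel_measurable (outputs_space B)"
    by (intro borel_measurable_sum)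
  show ?thesis unfolding batch_mean_def by measurable
qed

text \<open>The sign \<open>a\<close> covers both tails at once. The estimate is made for the
  unnormalised sum, whose moment factorises over the batch with parameter
  \<open>real B * v\<close>.\<close>

lemma batch_mean_tail:
  assumes x: "x \<in> X" and a: "\<bar>a\<bar> = 1"
    and mgf: "\<And>\<theta>. (\<integral>\<^sup>+\<omega>. ennreal (exp (\<theta> * (\<omega> - m))) \<partial>Q x) \<le> ennreal (exp (\<theta>\<^sup>2 * v))"
    and r: "r > 0" "l > 0" "4 * v * l \<le> real B * r\<^sup>2"
  shows "emeasure (law x) {z \<in> space (law x). r < a * (batch_mean z - m)} \<le> ennreal (exp (- l))"
proof -
  let ?P = "\<Pi>\<^sub>M i\<in>{..<B}. Q x"
  interpret L: prob_space "law x" by (rule law[OF x])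
  interpret f: prob_space "Pf x" by (rule Pf[OF x])
  interpret g: prob_space "Pg x" by (rule Pg[OF x])
  interpret fg: pair_prob_space "Pf x" "Pg x" ..
  interpret q: product_prob_space "\<lambda>_. Q x" "{..<B}"
    using Q[OF x] by (simp add: product_prob_space_def product_prob_space_axioms_def product_sigma_finite_def prob_space_imp_sigma_finite)
  have [measurable]: "batch_mean \<in> borel_measurable (law x)"
    using batch_mean_measurable by (subst measurable_cong_sets[OF law(2)[OF x] refl])
  have Bpos: "real B > 0" using B by simp
  have sum: "real B * (a * (batch_mean z - m)) = (\<Sum>i<B. a * (fst z i - m))" for z
    using Bpos by (simp add: batch_mean_def sum_distrib_left[symmetric] sum_subtractf field_simps)
  have "emeasure (law x) {z \<in> space (law x). real B * r < real B * (a * (batch_mean z - m))} \<le> ennreal (exp (- l))"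
  proof (rule L.subgaussian_tail[where v="real B * v"])
    fix \<theta> :: real
    let ?e = "\<lambda>\<omega>. ennreal (exp (\<theta> * a * (\<omega> - m)))"
    have e: "?e \<in> borel_measurable (Q x)" by (subst measurable_cong_sets[OF Q(2)[OF x] refl]) measurable
    have "(\<lambda>\<omega>. ?e (\<omega> i)) \<in> borel_measurable ?P" if "i \<in> {..<B}" for i
      by (rule measurable_compose[where f="\<lambda>\<omega>. \<omega> i" and g="?e", OF measurable_component_singleton[OF that] e])
    then have pr: "(\<lambda>\<omega>. \<Prod>i<B. ?e (\<omega> i)) \<in> borel_measurable ?P"
      by (rule borel_measurable_prod_ennreal)
    have "(\<integral>\<^sup>+z. ennreal (exp (\<theta> * (real B * (a * (batch_mean z - m))))) \<partial>law x) = (\<integral>\<^sup>+z. (\<Prod>i<B. ?e (fst z i)) \<partial>law x)"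
      unfolding sum by (simp add: sum_distrib_left exp_sum prod_ennreal mult_ac)
    also have "\<dots> = (\<integral>\<^sup>+\<omega>. (\<integral>\<^sup>+y. (\<Prod>i<B. ?e (fst (\<omega>, y) i)) \<partial>(Pf x \<Otimes>\<^sub>M Pg x)) \<partial>?P)"
      unfolding outputs_law_def
      by (intro fg.nn_integral_fst[symmetric] measurable_compose[OF measurable_fst pr])
    also have "\<dots> = (\<integral>\<^sup>+\<omega>. (\<Prod>i<B. ?e (\<omega> i)) \<partial>?P)" by (simp add: fg.emeasure_space_1)
    also have "\<dots> = (\<Prod>i<B. \<integral>\<^sup>+\<omega>. ?e \<omega> \<partial>Q x)" using e by (intro q.product_nn_integral_prod) auto
    also have "\<dots> \<le> (\<Prod>i<B. ennreal (exp (\<theta>\<^sup>2 * v)))"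
    proof (rule prod_mono_ennreal)
      have "(\<theta> * a)\<^sup>2 = \<theta>\<^sup>2" using a by (metis mult.right_neutral power2_abs power_mult_distrib power_one)
      then show "(\<integral>\<^sup>+\<omega>. ?e \<omega> \<partial>Q x) \<le> ennreal (exp (\<theta>\<^sup>2 * v))" using mgf[of "\<theta> * a"] by simp
    qed
    also have "\<dots> = ennreal (exp (\<theta>\<^sup>2 * (real B * v)))"
      by (simp add: prod_ennreal ennreal_power exp_of_nat_mult[symmetric] mult_ac)
    finally show "(\<integral>\<^sup>+z. ennreal (exp (\<theta> * (real B * (a * (batch_mean z - m))))) \<partial>law x) \<le> ennreal (exp (\<theta>\<^sup>2 * (real B * v)))" .
  next
    have "real B * (4 * v * l) \<le> real B * (real B * r\<^sup>2)" using r Bpos by (intro mult_left_mono) auto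
    then show "4 * (real B * v) * l \<le> (real B * r)\<^sup>2" by (simp add: power2_eq_square mult_ac)
  qed (use r Bpos in auto)
  then show ?thesis using Bpos by simp
qed

lemma batch_error_tail:
  assumes t: "t < T" and [measurable]: "m \<in> borel_measurable borel"
    and mgf: "\<And>\<theta> x. x \<in> X \<Longrightarrow> (\<integral>\<^sup>+\<omega>. ennreal (exp (\<theta> * (\<omega> - m x))) \<partial>Q x) \<le> ennreal (exp (\<theta>\<^sup>2 * v))"
    and r: "r > 0" "l > 0" "4 * v * l \<le> real B * r\<^sup>2"
  shows "emeasure \<Omega> {w \<in> space \<Omega>. r < \<bar>batch_mean (Z t w) - m (it w t)\<bar>} \<le> ennreal (2 * exp (- l))"
proof -
  note [measurable] = batch_mean_measurable it_Om[OF t] Z_measurable[OF t]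
  let ?A = "{v \<in> space (borel \<Otimes>\<^sub>M outputs_space B). r < \<bar>batch_mean (snd v) - m (fst v)\<bar>}"
  let ?H = "\<lambda>s. indicator ?A :: 'a \<times> 'a outputs \<Rightarrow> ennreal"
  \<comment> \<open>A product with one factor: the estimate for a fixed query point is averaged over
    the random iterate at time \<open>t\<close>.\<close>
  have "(\<integral>\<^sup>+w. (\<Prod>s=t..<Suc t. ?H s (it w s, Z s w)) \<partial>\<Omega>) \<le> (\<Prod>s=t..<Suc t. ennreal (2 * exp (- l)))"
  proof (rule nn_integral_prod_le)
    fix s x assume x: "x \<in> X"
    have [measurable]: "batch_mean \<in> borel_measurable (law x)"
      using batch_mean_measurable by (subst measurable_cong_sets[OF law(2)[OF x] refl])
    have "(\<integral>\<^sup>+z. ?H s (x, z) \<partial>law x) =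
       (\<integral>\<^sup>+z. indicator ({z \<in> space (law x). r < 1 * (batch_mean z - m x)} \<union> {z \<in> space (law x). r < (-1) * (batch_mean z - m x)}) z \<partial>law x)"
      using sets_eq_imp_space_eq[OF law(2)[OF x]]
      by (intro nn_integral_cong) (auto simp: indicator_def space_pair_measure)
    also have "\<dots> = emeasure (law x) ({z \<in> space (law x). r < 1 * (batch_mean z - m x)} \<union> {z \<in> space (law x). r < (-1) * (batch_mean z - m x)})"
      by (intro nn_integral_indicator) measurable
    also have "\<dots> \<le> emeasure (law x) {z \<in> space (law x). r < 1 * (batch_mean z - m x)} + emeasure (law x) {z \<in> space (law x). r < (-1) * (batch_mean z - m x)}"
      by (intro emeasure_subadditive) measurable
    also have "\<dots> \<le> ennreal (exp (- l)) + ennreal (exp (- l))"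
      using x mgf r by (intro add_mono batch_mean_tail[where v=v]) auto
    finally show "(\<integral>\<^sup>+z. ?H s (x, z) \<partial>law x) \<le> ennreal (2 * exp (- l))"
      by (simp flip: ennreal_plus)
  qed (use t in auto)
  moreover have "(\<integral>\<^sup>+w. (\<Prod>s=t..<Suc t. ?H s (it w s, Z s w)) \<partial>\<Omega>) =
      (\<integral>\<^sup>+w. indicator {w \<in> space \<Omega>. r < \<bar>batch_mean (Z t w) - m (it w t)\<bar>} w \<partial>\<Omega>)"
    using measurable_space[OF Z_measurable[OF t]]
    by (intro nn_integral_cong) (auto simp: indicator_def space_pair_measure)
  ultimately show ?thesis by simp
qed

text \<open>Each factor \<open>exp ((norm \<xi>)\<^sup>2 / M\<^sup>2)\<close> has conditional
  expectation at most e on either branch, so the exponential of the whole sum has expectation at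
  most \<open>exp (real (T - S))\<close>.\<close>

lemma square_sum_tail:
  assumes S: "S \<le> T"
    and f: "\<And>x. x \<in> X \<Longrightarrow> (\<integral>\<^sup>+\<xi>. ennreal (exp ((norm \<xi>)\<^sup>2 / M\<^sup>2)) \<partial>Pf x) \<le> ennreal (exp 1)"
    and g: "\<And>x. x \<in> X \<Longrightarrow> (\<integral>\<^sup>+\<xi>. ennreal (exp ((norm \<xi>)\<^sup>2 / M\<^sup>2)) \<partial>Pg x) \<le> ennreal (exp 1)"
  shows "emeasure \<Omega> {w \<in> space \<Omega>. real (T - S) + u < (\<Sum>t=S..<T. (norm (xi w t))\<^sup>2 / M\<^sup>2)} \<le> ennreal (exp (- u))"
proof (rule chernoff)
  show "(\<lambda>w. \<Sum>t=S..<T. (norm (xi w t))\<^sup>2 / M\<^sup>2) \<in> borel_measurable \<Omega>"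
  proof (rule borel_measurable_sum)
    fix t assume "t \<in> {S..<T}"
    then have [measurable]: "(\<lambda>w. xi w t) \<in> borel_measurable \<Omega>" by (intro xi_Om) simp
    show "(\<lambda>w. (norm (xi w t))\<^sup>2 / M\<^sup>2) \<in> borel_measurable \<Omega>" by measurable
  qed
  let ?q = "\<lambda>\<xi>::'a. ennreal (exp ((norm \<xi>)\<^sup>2 / M\<^sup>2))"
  let ?H = "\<lambda>t (v :: 'a \<times> 'a outputs). ?q (selected B tol t (snd v))"
  have "(\<integral>\<^sup>+w. (\<Prod>t=S..<T. ?H t (it w t, Z t w)) \<partial>\<Omega>) \<le> (\<Prod>t=S..<T. ennreal (exp 1))"
  proof (rule nn_integral_prod_le[OF _ _ S])
    fix t
    have [measurable]: "selected B tol t \<in> borel_measurable (outputs_space B)"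
      using selected_measurable[OF measurable_ident] by simp
    show "?H t \<in> borel_measurable (borel \<Otimes>\<^sub>M outputs_space B)"
      by measurable
    fix x assume "x \<in> X"
    then show "(\<integral>\<^sup>+z. ?H t (x, z) \<partial>law x) \<le> ennreal (exp 1)"
      using nn_integral_selected_le[of x ?q ?q "ennreal (exp 1)" t] f g by simp
  qed simp
  then show "(\<integral>\<^sup>+w. ennreal (exp (\<Sum>t=S..<T. (norm (xi w t))\<^sup>2 / M\<^sup>2)) \<partial>\<Omega>) \<le> ennreal (exp (real (T - S)))"
    by (simp add: exp_sum prod_ennreal xi_def ennreal_power exp_of_nat_mult[symmetric])
qed

text \<open>\<open>h\<close> will be the drift, which only bounds the conditional mean from below;
  hence moments are required for positive \<open>\<theta>\<close> alone. The parameter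
  \<open>v\<close> belongs to a unit step, and the step size enters by replacing
  \<open>\<theta>\<close> with \<open>\<theta> * \<eta> t\<close>.\<close>

lemma noise_sum_tail:
  assumes S: "S \<le> T" and \<eta>: "\<And>t. \<eta> t > 0"
    and [measurable]: "\<And>b. h b \<in> borel_measurable borel" "d \<in> borel_measurable borel"
    and f: "\<And>\<theta> x. \<theta> > 0 \<Longrightarrow> x \<in> X \<Longrightarrow> (\<integral>\<^sup>+\<xi>. ennreal (exp (\<theta> * (h True x - \<xi> \<bullet> d x))) \<partial>Pf x) \<le> ennreal (exp (\<theta>\<^sup>2 * v))"
    and g: "\<And>\<theta> x. \<theta> > 0 \<Longrightarrow> x \<in> X \<Longrightarrow> (\<integral>\<^sup>+\<xi>. ennreal (exp (\<theta> * (h False x - \<xi> \<bullet> d x))) \<partial>Pg x) \<le> ennreal (exp (\<theta>\<^sup>2 * v))"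
    and N: "N > 0" "l > 0" "4 * (v * (\<Sum>t=S..<T. (\<eta> t)\<^sup>2)) * l \<le> N\<^sup>2"
  shows "emeasure \<Omega> {w \<in> space \<Omega>. N < (\<Sum>t=S..<T. \<eta> t * (h (stp w t) (it w t) - xi w t \<bullet> d (it w t)))} \<le> ennreal (exp (- l))"
proof (rule subgaussian_tail)
  have "(\<lambda>w. \<eta> t * (h (stp w t) (it w t) - xi w t \<bullet> d (it w t))) \<in> borel_measurable \<Omega>" if "t < T" for t
  proof -
    note [measurable] = it_Om[OF that] xi_Om[OF that] stp_Om[OF that]
    have "(\<lambda>w. h (stp w t) (it w t)) = (\<lambda>w. if stp w t then h True (it w t) else h False (it w t))"
      by auto
    then have [measurable]: "(\<lambda>w. h (stp w t) (it w t)) \<in> borel_measurable \<Omega>" by simp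
    show ?thesis by measurable
  qed
  then show "(\<lambda>w. \<Sum>t=S..<T. \<eta> t * (h (stp w t) (it w t) - xi w t \<bullet> d (it w t))) \<in> borel_measurable \<Omega>"
    by (intro borel_measurable_sum) auto
next
  fix \<theta> :: real assume \<theta>: "\<theta> > 0"
  let ?q = "\<lambda>b t x (\<xi>::'a). ennreal (exp (\<theta> * \<eta> t * (h b x - \<xi> \<bullet> d x)))"
  let ?H = "\<lambda>t (v :: 'a \<times> 'a outputs). if f_step B tol (\<lambda>_. snd v) t
     then ?q True t (fst v) (selected B tol t (snd v)) else ?q False t (fst v) (selected B tol t (snd v))"
  have "(\<integral>\<^sup>+w. (\<Prod>t=S..<T. ?H t (it w t, Z t w)) \<partial>\<Omega>) \<le> (\<Prod>t=S..<T. ennreal (exp ((\<theta> * \<eta> t)\<^sup>2 * v)))"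
  proof (rule nn_integral_prod_le[OF _ _ S])
    fix t
    have [measurable]: "selected B tol t \<in> borel_measurable (outputs_space B)"
       "Measurable.pred (outputs_space B) (\<lambda>z. f_step B tol (\<lambda>_. z) t)"
      using selected_measurable[OF measurable_ident] f_step_measurable[OF measurable_ident] by auto
    show "?H t \<in> borel_measurable (borel \<Otimes>\<^sub>M outputs_space B)"
      by measurable
    fix x assume "x \<in> X"
    then show "(\<integral>\<^sup>+z. ?H t (x, z) \<partial>law x) \<le> ennreal (exp ((\<theta> * \<eta> t)\<^sup>2 * v))"
      unfolding fst_conv snd_conv
      using nn_integral_selected_le[of x "?q True t x" "?q False t x" "ennreal (exp ((\<theta> * \<eta> t)\<^sup>2 * v))" t]
        f[of "\<theta> * \<eta> t" x] g[of "\<theta> * \<eta> t" x] \<theta> \<eta>[of t] by simp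
  qed simp
  moreover have "?H t (it w t, Z t w) = ennreal (exp (\<theta> * (\<eta> t * (h (stp w t) (it w t) - xi w t \<bullet> d (it w t)))))" for w t
    by (simp add: stp_single xi_def mult.assoc)
  moreover have "(\<Prod>t=S..<T. ennreal (exp ((\<theta> * \<eta> t)\<^sup>2 * v))) = ennreal (exp (\<theta>\<^sup>2 * (v * (\<Sum>t=S..<T. (\<eta> t)\<^sup>2))))"
    by (simp add: prod_ennreal exp_sum[symmetric] sum_distrib_left power_mult_distrib mult_ac)
  ultimately show "(\<integral>\<^sup>+w. ennreal (exp (\<theta> * (\<Sum>t=S..<T. \<eta> t * (h (stp w t) (it w t) - xi w t \<bullet> d (it w t))))) \<partial>\<Omega>)
      \<le> ennreal (exp (\<theta>\<^sup>2 * (v * (\<Sum>t=S..<T. (\<eta> t)\<^sup>2))))"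
    by (simp add: sum_distrib_left exp_sum prod_ennreal)
qed (use N in auto)

end

section \<open>The guarantee\<close>

lemma expectation_tau_pmf:
  fixes h :: "nat \<Rightarrow> real"
  assumes I: "finite I" "I \<noteq> {}" and \<eta>: "\<And>t. \<eta> t > 0"
  shows "measure_pmf.expectation (tau_pmf \<eta> I) h = (\<Sum>t\<in>I. \<eta> t * h t) / (\<Sum>t\<in>I. \<eta> t)"
proof -
  let ?p = "\<lambda>t. if t \<in> I then \<eta> t / (\<Sum>s\<in>I. \<eta> s) else 0"
  have pos: "(\<Sum>s\<in>I. \<eta> s) > 0" using I \<eta> by (intro sum_pos) auto
  then have nn: "\<And>t. 0 \<le> ?p t" using \<eta> by (auto intro!: divide_nonneg_pos less_imp_le)
  have "(\<integral>\<^sup>+t. ennreal (?p t) \<partial>count_space UNIV) = (\<Sum>t\<in>I. ennreal (?p t))"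
    using I by (intro nn_integral_count_space'[where A=I]) auto
  also have "\<dots> = ennreal (\<Sum>t\<in>I. ?p t)" by (intro sum_ennreal nn)
  also have "(\<Sum>t\<in>I. ?p t) = 1" using pos by (simp add: sum_divide_distrib[symmetric])
  finally have "(\<integral>\<^sup>+t. ennreal (?p t) \<partial>count_space UNIV) = 1" by simp
  from pmf_embed_pmf[OF nn this] have p: "pmf (tau_pmf \<eta> I) t = ?p t" for t
    by (simp add: tau_pmf_def)
  have "measure_pmf.expectation (tau_pmf \<eta> I) h = (\<Sum>t\<in>I. h t * pmf (tau_pmf \<eta> I) t)"
    using I p by (intro integral_measure_pmf_real) (auto simp: set_pmf_iff split: if_splits)
  also have "\<dots> = (\<Sum>t\<in>I. \<eta> t * h t) / (\<Sum>t\<in>I. \<eta> t)"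
    by (simp add: p sum_divide_distrib mult.commute)
  finally show ?thesis .
qed

context constrained_prox
begin

text \<open>For \<open>\<theta> > 0\<close>, replacing the drift by the larger true mean only
  increases the integrand and leaves centred noise.\<close>

lemma drift_noise_mgf:
  assumes P: "prob_space P" "integrable P (\<lambda>\<xi>. \<xi>)"
    and m: "norm (\<integral>\<xi>. \<xi> \<partial>P) \<le> M"
    and q: "(\<integral>\<^sup>+\<xi>. ennreal (exp ((norm \<xi>)\<^sup>2 / M\<^sup>2)) \<partial>P) \<le> ennreal (exp 1)"
    and x: "x \<in> X" and le: "drift b x \<le> (\<integral>\<xi>. \<xi> \<partial>P) \<bullet> (x - p x)" and \<theta>: "\<theta> > 0"
  shows "(\<integral>\<^sup>+\<xi>. ennreal (exp (\<theta> * (drift b x - \<xi> \<bullet> (x - p x)))) \<partial>P) \<le> ennreal (exp (\<theta>\<^sup>2 * (2 * M * D)\<^sup>2))"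
proof -
  interpret prob_space P by fact
  have "(\<integral>\<^sup>+\<xi>. ennreal (exp (\<theta> * (drift b x - \<xi> \<bullet> (x - p x)))) \<partial>P) \<le>
      (\<integral>\<^sup>+\<xi>. ennreal (exp (\<theta> * (((\<integral>\<xi>. \<xi> \<partial>P) - \<xi>) \<bullet> (x - p x)))) \<partial>P)"
    using le \<theta> by (intro nn_integral_mono ennreal_leI) (simp add: inner_diff_left)
  also have "\<dots> \<le> ennreal (exp (\<theta>\<^sup>2 * (2 * M * D)\<^sup>2))"
    using P m M q D diam[OF x p_mem[OF x]] by (intro vector_noise_mgf) auto
  finally show ?thesis .
qed

end

text \<open>The parameters stay free so that both cases are instances. \<open>r\<close> bounds the
  mini-batch errors, \<open>V\<close> the weighted squares (through the uniform step bound
  \<open>W\<close>) and \<open>N\<close> the noise; \<open>l1\<close>, \<open>u\<close> and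
  \<open>l2\<close> are the exponents of the failure probabilities, which are added by a union
  bound.\<close>

lemma switching_guarantee:
  fixes X :: "'a::euclidean_space set"
  assumes opt: "constrained_prox X f g p M D \<rho> \<rho>h Lam x_feas"
    and run: "switching_process \<Omega> X T B tol \<eta> x0 Q Pf Pg Z"
    and g: "continuous_on X g"
    and Q: "\<And>\<theta> x. x \<in> X \<Longrightarrow> (\<integral>\<^sup>+\<omega>. ennreal (exp (\<theta> * (\<omega> - g x))) \<partial>Q x) \<le> ennreal (exp (\<theta>\<^sup>2 * \<sigma>\<^sup>2))"
    and Pf: "\<And>x. x \<in> X \<Longrightarrow> (\<integral>\<^sup>+\<xi>. ennreal (exp ((norm \<xi>)\<^sup>2 / M\<^sup>2)) \<partial>Pf x) \<le> ennreal (exp 1)"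
      "\<And>x. x \<in> X \<Longrightarrow> integrable (Pf x) (\<lambda>\<xi>. \<xi>) \<and> norm (\<integral>\<xi>. \<xi> \<partial>Pf x) \<le> M \<and>
        (\<forall>y\<in>X. f y \<ge> f x + (\<integral>\<xi>. \<xi> \<partial>Pf x) \<bullet> (y - x) - \<rho> / 2 * (norm (y - x))\<^sup>2)"
    and Pg: "\<And>x. x \<in> X \<Longrightarrow> (\<integral>\<^sup>+\<xi>. ennreal (exp ((norm \<xi>)\<^sup>2 / M\<^sup>2)) \<partial>Pg x) \<le> ennreal (exp 1)"
      "\<And>x. x \<in> X \<Longrightarrow> integrable (Pg x) (\<lambda>\<xi>. \<xi>) \<and> norm (\<integral>\<xi>. \<xi> \<partial>Pg x) \<le> M \<and>
        (\<forall>y\<in>X. g y \<ge> g x + (\<integral>\<xi>. \<xi> \<partial>Pg x) \<bullet> (y - x))"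
    and S: "S \<le> T" and \<eta>: "\<And>t. \<eta> t > 0" and \<epsilon>: "\<epsilon> > 0"
    and A: "(1 + Lam) * A = \<epsilon>\<^sup>2 * (\<rho>h - \<rho>)"
    and tol: "\<And>t. S \<le> t \<Longrightarrow> t < T \<Longrightarrow> 0 \<le> tol t \<and> tol t \<le> A"
    and r: "0 < r" "r \<le> A" "0 < l1" "4 * \<sigma>\<^sup>2 * l1 \<le> real B * r\<^sup>2"
    and W: "0 \<le> W" "\<And>t. S \<le> t \<Longrightarrow> t < T \<Longrightarrow> (\<eta> t)\<^sup>2 * M\<^sup>2 \<le> W" "W * (real (T - S) + u) \<le> V"
    and N: "0 < N" "0 < l2" "4 * ((2 * M * D)\<^sup>2 * (\<Sum>t=S..<T. (\<eta> t)\<^sup>2)) * l2 \<le> N\<^sup>2"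
    and budget: "D\<^sup>2 / 2 + V / 2 + N < (\<Sum>t=S..<T. \<eta> t * (tol t - (1 + Lam) * r))"
    and \<delta>: "real (T - S) * (2 * exp (- l1)) + exp (- u) + exp (- l2) \<le> \<delta>"
  shows "measure \<Omega> {w \<in> space \<Omega>.
      let x = iterate X B tol \<eta> x0 (\<lambda>s. Z s w);
          I = index_set S T B tol (\<lambda>s. Z s w)
      in I \<noteq> {} \<and>
         measure_pmf.expectation (tau_pmf \<eta> I) (\<lambda>t. norm (p (x t) - x t)) \<le> \<epsilon> \<and>
         measure_pmf.expectation (tau_pmf \<eta> I) (\<lambda>t. g (x t)) \<le> 2 * A}
    \<ge> 1 - \<delta>"
proof -
  interpret opt: constrained_prox X f g p M D \<rho> \<rho>h Lam x_feas by (rule opt)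
  interpret run: switching_process \<Omega> X T B tol \<eta> x0 Q Pf Pg Z by (rule run)
  \<comment> \<open>Extension by zero makes these maps Borel on the whole space. The iterates never
    leave \<open>X\<close>, so the values along the run are unchanged.\<close>
  define h where "h b x = (if x \<in> X then opt.drift b x else 0)" for b x
  define d where "d x = (if x \<in> X then x - p x else 0)" for x
  define g' where "g' x = (if x \<in> X then g x else 0)" for x
  have [measurable]: "X \<in> sets borel" using opt.closed by simp
  have h[measurable]: "h b \<in> borel_measurable borel" for b
    unfolding h_def opt.drift_def using g opt.continuous_on_p
    by (cases b) (auto intro!: borel_measurable_continuous_on_if continuous_intros)
  have d[measurable]: "d \<in> borel_measurable borel"
    unfolding d_def using opt.continuous_on_p
    by (intro borel_measurable_continuous_on_if continuous_intros) auto
  have g'[measurable]: "g' \<in> borel_measurable borel"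
    unfolding g'_def using g by (intro borel_measurable_continuous_on_if continuous_intros) auto
  let ?I = "\<lambda>w. {t. S \<le> t \<and> t < T \<and> run.stp w t}"
  let ?Err = "\<lambda>t. {w \<in> space \<Omega>. r < \<bar>run.batch_mean (Z t w) - g' (run.it w t)\<bar>}"
  let ?Sq = "{w \<in> space \<Omega>. real (T - S) + u < (\<Sum>t=S..<T. (norm (run.xi w t))\<^sup>2 / M\<^sup>2)}"
  let ?No = "{w \<in> space \<Omega>. N < (\<Sum>t=S..<T. \<eta> t * (h (run.stp w t) (run.it w t) - run.xi w t \<bullet> d (run.it w t)))}"
  let ?G = "{w \<in> space \<Omega>. ?I w \<noteq> {} \<and>
      (\<Sum>t\<in>?I w. \<eta> t * norm (d (run.it w t))) / (\<Sum>t\<in>?I w. \<eta> t) \<le> \<epsilon> \<and>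
      (\<Sum>t\<in>?I w. \<eta> t * g' (run.it w t)) / (\<Sum>t\<in>?I w. \<eta> t) \<le> 2 * A}"
  have [measurable]: "(\<lambda>w. run.it w t) \<in> borel_measurable \<Omega>" "(\<lambda>w. run.xi w t) \<in> borel_measurable \<Omega>"
    "Measurable.pred \<Omega> (\<lambda>w. run.stp w t)" "(\<lambda>w. run.batch_mean (Z t w)) \<in> borel_measurable \<Omega>"
    if "t \<in> {S..<T}" for t
    using that run.it_Om run.xi_Om run.stp_Om measurable_compose[OF run.Z_measurable run.batch_mean_measurable] by simp_all
  \<comment> \<open>The index set is itself random; splitting according to its finitely many values
    \<open>J\<close> leaves sums over a fixed set.\<close>
  have G: "?G \<in> sets \<Omega>"
  proof -
    have J: "{w \<in> space \<Omega>. \<forall>t\<in>{S..<T}. run.stp w t \<longleftrightarrow> t \<in> J} \<in> sets \<Omega>" for J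
      by measurable
    have K: "{w \<in> space \<Omega>. (\<Sum>t\<in>J. \<eta> t * norm (d (run.it w t))) / (\<Sum>t\<in>J. \<eta> t) \<le> \<epsilon> \<and>
      (\<Sum>t\<in>J. \<eta> t * g' (run.it w t)) / (\<Sum>t\<in>J. \<eta> t) \<le> 2 * A} \<in> sets \<Omega>" if "J \<subseteq> {S..<T}" for J
    proof -
      have [measurable]: "(\<lambda>w. run.it w t) \<in> borel_measurable \<Omega>" if "t \<in> J" for t
        using that \<open>J \<subseteq> _\<close> run.it_Om by auto
      show ?thesis by measurable
    qed
    have "?G = (\<Union>J\<in>Pow {S..<T} - {{}}. {w \<in> space \<Omega>. \<forall>t\<in>{S..<T}. run.stp w t \<longleftrightarrow> t \<in> J} \<inter>
      {w \<in> space \<Omega>. (\<Sum>t\<in>J. \<eta> t * norm (d (run.it w t))) / (\<Sum>t\<in>J. \<eta> t) \<le> \<epsilon> \<and>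
      (\<Sum>t\<in>J. \<eta> t * g' (run.it w t)) / (\<Sum>t\<in>J. \<eta> t) \<le> 2 * A})" (is "_ = ?U")
    proof (intro set_eqI iffI)
      fix w assume w: "w \<in> ?G"
      have "?I w \<in> Pow {S..<T} - {{}}" "\<forall>t\<in>{S..<T}. run.stp w t \<longleftrightarrow> t \<in> ?I w" using w by auto
      with w show "w \<in> ?U" by blast
    next
      fix w assume "w \<in> ?U"
      then obtain J where J: "J \<in> Pow {S..<T} - {{}}" "\<forall>t\<in>{S..<T}. run.stp w t \<longleftrightarrow> t \<in> J"
        and rest: "w \<in> {w \<in> space \<Omega>. (\<Sum>t\<in>J. \<eta> t * norm (d (run.it w t))) / (\<Sum>t\<in>J. \<eta> t) \<le> \<epsilon> \<and>
      (\<Sum>t\<in>J. \<eta> t * g' (run.it w t)) / (\<Sum>t\<in>J. \<eta> t) \<le> 2 * A}" by blast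
      have eq: "?I w = J" using J by fastforce
      show "w \<in> ?G" using J(1) rest unfolding mem_Collect_eq eq by blast
    qed
    also have "\<dots> \<in> sets \<Omega>"
      by (intro sets.finite_UN sets.Int J K) auto
    finally show ?thesis .
  qed
  have Err: "emeasure \<Omega> (?Err t) \<le> ennreal (2 * exp (- l1))" if "t \<in> {S..<T}" for t
  proof (rule run.batch_error_tail[OF _ g' _ r(1) r(3) r(4)])
    show "(\<integral>\<^sup>+\<omega>. ennreal (exp (\<theta> * (\<omega> - g' x))) \<partial>Q x) \<le> ennreal (exp (\<theta>\<^sup>2 * \<sigma>\<^sup>2))" if "x \<in> X"
      for \<theta> :: real and x :: 'a
      using Q[OF that] that by (simp add: g'_def)
  qed (use that in simp)
  have Sq: "emeasure \<Omega> ?Sq \<le> ennreal (exp (- u))"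
    using S Pf Pg by (intro run.square_sum_tail) auto
  have No: "emeasure \<Omega> ?No \<le> ennreal (exp (- l2))"
  proof (rule run.noise_sum_tail[where v="(2 * M * D)\<^sup>2"])
    fix \<theta> :: real and x :: 'a assume *: "\<theta> > 0" "x \<in> X"
    show "(\<integral>\<^sup>+\<xi>. ennreal (exp (\<theta> * (h True x - \<xi> \<bullet> d x))) \<partial>Pf x) \<le> ennreal (exp (\<theta>\<^sup>2 * (2 * M * D)\<^sup>2))"
      using opt.drift_noise_mgf[where P="Pf x" and x=x and \<theta>=\<theta> and b=True] opt.drift_le_f[of x] run.Pf(1) Pf *
      by (simp add: h_def d_def)
    show "(\<integral>\<^sup>+\<xi>. ennreal (exp (\<theta> * (h False x - \<xi> \<bullet> d x))) \<partial>Pg x) \<le> ennreal (exp (\<theta>\<^sup>2 * (2 * M * D)\<^sup>2))"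
      using opt.drift_noise_mgf[where P="Pg x" and x=x and \<theta>=\<theta> and b=False] opt.drift_le_g[of x] run.Pg(1) Pg *
      by (simp add: h_def d_def)
  qed (use S \<eta> N h d in auto)
  have good: "w \<in> ?G" if w: "w \<in> space \<Omega>" "w \<notin> (\<Union>t\<in>{S..<T}. ?Err t)" "w \<notin> ?Sq" "w \<notin> ?No" for w
  proof -
    let ?x = "run.it w"
    have inX: "\<And>t. ?x t \<in> X" by (rule run.it_mem)
    have err: "\<bar>run.batch_mean (Z t w) - g (?x t)\<bar> \<le> r" if "S \<le> t" "t < T" for t
    proof -
      have "\<bar>run.batch_mean (Z t w) - g' (?x t)\<bar> \<le> r" using w(1,2) that by (auto simp: not_less)
      then show ?thesis using inX[of t] by (simp add: g'_def)
    qed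
    have sq: "(\<Sum>t=S..<T. (\<eta> t)\<^sup>2 * (norm (run.xi w t))\<^sup>2) \<le> V"
    proof -
      have "(\<Sum>t=S..<T. (\<eta> t)\<^sup>2 * (norm (run.xi w t))\<^sup>2) \<le> (\<Sum>t=S..<T. W * ((norm (run.xi w t))\<^sup>2 / M\<^sup>2))"
      proof (rule sum_mono)
        fix t assume "t \<in> {S..<T}"
        then have "(\<eta> t)\<^sup>2 * M\<^sup>2 * ((norm (run.xi w t))\<^sup>2 / M\<^sup>2) \<le> W * ((norm (run.xi w t))\<^sup>2 / M\<^sup>2)"
          using W by (intro mult_right_mono) auto
        then show "(\<eta> t)\<^sup>2 * (norm (run.xi w t))\<^sup>2 \<le> W * ((norm (run.xi w t))\<^sup>2 / M\<^sup>2)"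
          using opt.M by simp
      qed
      also have "\<dots> = W * (\<Sum>t=S..<T. (norm (run.xi w t))\<^sup>2 / M\<^sup>2)" by (simp add: sum_distrib_left)
      also have "\<dots> \<le> W * (real (T - S) + u)" using w W by (intro mult_left_mono) (auto simp: not_less)
      finally show ?thesis using W by simp
    qed
    have noise: "(\<Sum>t=S..<T. \<eta> t * (opt.drift (run.stp w t) (?x t) - run.xi w t \<bullet> (?x t - p (?x t)))) \<le> N"
      using w(1,4) by (simp add: h_def d_def inX not_less)
    have key: "(\<Sum>t\<in>?I w. \<eta> t * (norm (p (?x t) - ?x t))\<^sup>2) < \<epsilon>\<^sup>2 * (\<Sum>t\<in>?I w. \<eta> t)"
    proof (rule opt.switching_bound[OF inX run.it_Suc S \<eta> less_imp_le[OF r(1)] A tol _ _ noise sq budget refl])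
      fix t assume t: "S \<le> t" "t < T"
      show "g (?x t) \<le> tol t + r" if "run.stp w t"
        using err[OF t] that by (simp add: run.stp_iff)
      show "tol t - r \<le> g (?x t)" if "\<not> run.stp w t"
        using err[OF t] that by (simp add: run.stp_iff)
    qed
    \<comment> \<open>For an empty index set the strict inequality \<open>key\<close> would read 0 <
      0.\<close>
    have ne: "?I w \<noteq> {}"
    proof
      assume eq: "?I w = {}"
      show False using key unfolding eq by simp
    qed
    have fin: "finite (?I w)" by simp
    have pos: "(\<Sum>t\<in>?I w. \<eta> t) > 0" using ne fin \<eta> by (intro sum_pos) auto
    \<comment> \<open>Young's inequality with weight \<open>\<epsilon>\<close> passes from squared
      residuals to residuals, in place of Jensen's inequality for the weighted mean.\<close>
    have "(\<Sum>t\<in>?I w. \<eta> t * norm (d (?x t))) \<le> (\<Sum>t\<in>?I w. \<eta> t * (((norm (p (?x t) - ?x t))\<^sup>2 / \<epsilon> + \<epsilon>) / 2))"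
    proof (intro sum_mono mult_left_mono)
      fix t
      let ?n = "norm (p (?x t) - ?x t)"
      have "0 \<le> (?n - \<epsilon>)\<^sup>2" by simp
      then have "?n \<le> (?n\<^sup>2 / \<epsilon> + \<epsilon>) / 2"
        using \<epsilon> by (simp add: power2_diff field_simps power2_eq_square)
      then show "norm (d (?x t)) \<le> (?n\<^sup>2 / \<epsilon> + \<epsilon>) / 2"
        using inX[of t] by (simp add: d_def norm_minus_commute)
    qed (use \<eta> in \<open>auto simp: less_imp_le\<close>)
    also have "\<dots> = ((\<Sum>t\<in>?I w. \<eta> t * (norm (p (?x t) - ?x t))\<^sup>2) / \<epsilon> + \<epsilon> * (\<Sum>t\<in>?I w. \<eta> t)) / 2"
      by (simp add: sum_divide_distrib sum_distrib_left distrib_left add_divide_distrib sum.distrib mult_ac)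
    also have "\<dots> \<le> (\<epsilon>\<^sup>2 * (\<Sum>t\<in>?I w. \<eta> t) / \<epsilon> + \<epsilon> * (\<Sum>t\<in>?I w. \<eta> t)) / 2"
      using key \<epsilon> by (intro divide_right_mono add_right_mono) auto
    also have "\<dots> = \<epsilon> * (\<Sum>t\<in>?I w. \<eta> t)" using \<epsilon> by (simp add: power2_eq_square)
    finally have 1: "(\<Sum>t\<in>?I w. \<eta> t * norm (d (?x t))) / (\<Sum>t\<in>?I w. \<eta> t) \<le> \<epsilon>"
      using pos by (simp add: pos_divide_le_eq)
    \<comment> \<open>On an f-step the constraint value is at most \<open>tol t + r\<close>, and
      both summands are at most \<open>A\<close>.\<close>
    have "(\<Sum>t\<in>?I w. \<eta> t * g' (?x t)) \<le> (\<Sum>t\<in>?I w. \<eta> t * (2 * A))"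
    proof (intro sum_mono mult_left_mono)
      fix t assume "t \<in> ?I w"
      then show "g' (?x t) \<le> 2 * A"
        using err[of t] tol[of t] r inX[of t] by (auto simp: run.stp_iff g'_def)
    qed (use \<eta> in \<open>auto simp: less_imp_le\<close>)
    also have "\<dots> = 2 * A * (\<Sum>t\<in>?I w. \<eta> t)" by (simp add: sum_distrib_left mult_ac)
    finally have 2: "(\<Sum>t\<in>?I w. \<eta> t * g' (?x t)) / (\<Sum>t\<in>?I w. \<eta> t) \<le> 2 * A"
      using pos by (simp add: pos_divide_le_eq)
    show ?thesis using w(1) ne 1 2 by simp
  qed
  have ErrS: "?Err t \<in> sets \<Omega>" if "t \<in> {S..<T}" for t
    using that by measurable
  have "(\<lambda>w. h (run.stp w t) (run.it w t)) = (\<lambda>w. if run.stp w t then h True (run.it w t) else h False (run.it w t))" for t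
    by auto
  then have [measurable]: "(\<lambda>w. h (run.stp w t) (run.it w t)) \<in> borel_measurable \<Omega>" if "t \<in> {S..<T}" for t
    using that by simp
  have SqS: "?Sq \<in> sets \<Omega>" and NoS: "?No \<in> sets \<Omega>" by measurable
  have "emeasure \<Omega> (space \<Omega> - ?G) \<le> emeasure \<Omega> ((\<Union>t\<in>{S..<T}. ?Err t) \<union> ?Sq \<union> ?No)"
    using good SqS NoS ErrS by (intro emeasure_mono sets.Un sets.finite_UN) blast+
  also have "\<dots> \<le> emeasure \<Omega> (\<Union>t\<in>{S..<T}. ?Err t) + emeasure \<Omega> ?Sq + emeasure \<Omega> ?No"
    using SqS NoS ErrS
    by (intro order.trans[OF emeasure_subadditive] add_right_mono emeasure_subadditive sets.Un sets.finite_UN) auto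
  also have "\<dots> \<le> (\<Sum>t=S..<T. emeasure \<Omega> (?Err t)) + emeasure \<Omega> ?Sq + emeasure \<Omega> ?No"
    using ErrS by (intro add_right_mono emeasure_subadditive_finite) auto
  also have "\<dots> \<le> (\<Sum>t=S..<T. ennreal (2 * exp (- l1))) + ennreal (exp (- u)) + ennreal (exp (- l2))"
    using Err Sq No by (intro add_mono sum_mono)
  also have "\<dots> = ennreal (real (T - S) * (2 * exp (- l1)) + exp (- u) + exp (- l2))"
    by (subst sum_ennreal) (simp_all add: ennreal_plus[symmetric] del: ennreal_plus)
  also have "\<dots> \<le> ennreal \<delta>" using \<delta> by (rule ennreal_leI)
  finally have "emeasure \<Omega> (space \<Omega> - ?G) \<le> ennreal \<delta>" .
  moreover have "\<delta> \<ge> 0"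
    using \<delta> by (rule order.trans[rotated]) simp
  ultimately have "run.prob (space \<Omega> - ?G) \<le> \<delta>"
    by (simp add: run.emeasure_eq_measure)
  then have "1 - \<delta> \<le> run.prob ?G" using run.prob_compl[OF G] by simp
  also have "?G = {w \<in> space \<Omega>.
      let x = iterate X B tol \<eta> x0 (\<lambda>s. Z s w);
          I = index_set S T B tol (\<lambda>s. Z s w)
      in I \<noteq> {} \<and>
         measure_pmf.expectation (tau_pmf \<eta> I) (\<lambda>t. norm (p (x t) - x t)) \<le> \<epsilon> \<and>
         measure_pmf.expectation (tau_pmf \<eta> I) (\<lambda>t. g (x t)) \<le> 2 * A}"
  proof -
    have I: "index_set S T B tol (\<lambda>s. Z s w) = ?I w" and x: "iterate X B tol \<eta> x0 (\<lambda>s. Z s w) = run.it w" for w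
      by (simp_all add: index_set_def run.stp_def run.it_def)
    have "norm (p (run.it w t) - run.it w t) = norm (d (run.it w t))" "g (run.it w t) = g' (run.it w t)" for w t
      using run.it_mem[of w t] by (simp_all add: d_def g'_def norm_minus_commute)
    then show ?thesis
      unfolding Let_def I x by (intro Collect_cong conj_cong refl) (simp_all add: expectation_tau_pmf[OF _ _ \<eta>])
  qed
  finally show ?thesis .
qed

section \<open>From extended-real data to real-valued functions\<close>

lemma subdiff_bounded_imp_finite:
  fixes h :: "'a::euclidean_space \<Rightarrow> ereal"
  assumes "h x \<noteq> -\<infinity>" "subdiff h x \<noteq> {}" and M: "\<And>\<zeta>. \<zeta> \<in> subdiff h x \<Longrightarrow> norm \<zeta> \<le> M"
  shows "\<bar>h x\<bar> \<noteq> \<infinity>"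
proof
  assume "\<bar>h x\<bar> = \<infinity>"
  then have inf: "h x = \<infinity>" using assms(1) by (cases "h x") auto
  from assms(2) obtain \<zeta> and r :: "'a \<Rightarrow> real" where r: "r \<in> o[at x](\<lambda>x'. norm (x' - x))"
    and ev: "\<forall>\<^sub>F x' in at x. h x' \<ge> h x + ereal (\<zeta> \<bullet> (x' - x) + r x')"
    unfolding subdiff_def by blast
  \<comment> \<open>If \<open>h x\<close> is infinite, \<open>ev\<close> forces \<open>h\<close> to
    be infinite near \<open>x\<close>, so every vector satisfies the inequality with the same
    remainder; an unbounded subdifferential contradicts \<open>M\<close>.\<close>
  have "\<zeta>' \<in> subdiff h x" for \<zeta>'
    unfolding subdiff_def mem_Collect_eq
  proof (intro exI conjI)
    show "\<forall>\<^sub>F x' in at x. h x' \<ge> h x + ereal (\<zeta>' \<bullet> (x' - x) + r x')"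
      using ev by eventually_elim (simp add: inf)
  qed (rule r)
  moreover obtain v :: 'a where "norm v = \<bar>M\<bar> + 1"
    using vector_choose_size[of "\<bar>M\<bar> + 1"] by auto
  ultimately show False using M[of v] by auto
qed

lemma compact_if_diam_bounded:
  fixes X :: "'a::euclidean_space set"
  assumes "closed X" "\<And>x x'. x \<in> X \<Longrightarrow> x' \<in> X \<Longrightarrow> norm (x - x') \<le> D"
  shows "compact X"
proof (cases "X = {}")
  case False
  then obtain a where "a \<in> X" by auto
  then have "X \<subseteq> cball a D" using assms(2) by (auto simp: dist_norm)
  then show ?thesis using assms(1) bounded_subset compact_eq_bounded_closed by blast
qed simp

text \<open>\<open>arg_min\<close> is a choice operator, so a minimiser must be exhibited before
  anything follows about the chosen point; compactness of the feasible set and the point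
  \<open>y0\<close> supply one.\<close>

lemma prox_point_minimizes:
  fixes fr gr :: "'a::euclidean_space \<Rightarrow> real"
  assumes "compact X" and f: "\<And>x. x \<in> X \<Longrightarrow> f x = ereal (fr x)" and g: "\<And>x. x \<in> X \<Longrightarrow> g x = ereal (gr x)"
    and "continuous_on X fr" "continuous_on X gr" and y0: "y0 \<in> X" "gr y0 \<le> 0"
  shows "prox_point X f g \<rho>h x \<in> X \<and> gr (prox_point X f g \<rho>h x) \<le> 0 \<and> (\<forall>y\<in>X. gr y \<le> 0 \<longrightarrow>
    fr (prox_point X f g \<rho>h x) + \<rho>h / 2 * (norm (prox_point X f g \<rho>h x - x))\<^sup>2 \<le> fr y + \<rho>h / 2 * (norm (y - x))\<^sup>2)"
proof -
  let ?C = "{y \<in> X. gr y \<le> 0}" and ?\<phi> = "\<lambda>y. fr y + \<rho>h / 2 * (norm (y - x))\<^sup>2"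
  have "closed ?C"
    using assms(1,5) by (intro continuous_on_closed_Collect_le continuous_on_const compact_imp_closed)
  then have "compact (X \<inter> ?C)" using assms(1) by (rule compact_Int_closed[rotated])
  then have "compact ?C" by (simp add: Int_def)
  moreover have "continuous_on ?C ?\<phi>"
    using assms(4) by (intro continuous_intros) (auto intro: continuous_on_subset)
  ultimately obtain m where m: "m \<in> ?C" "\<And>y. y \<in> ?C \<Longrightarrow> ?\<phi> m \<le> ?\<phi> y"
    using continuous_attains_inf[of ?C ?\<phi>] y0 by blast
  let ?Q = "\<lambda>y. y \<in> X \<and> g y \<le> 0" and ?F = "\<lambda>y. f y + ereal (\<rho>h / 2 * (norm (y - x))\<^sup>2)"
  have Q: "?Q y \<longleftrightarrow> y \<in> ?C" for y using g by auto
  have F: "?F y = ereal (?\<phi> y)" if "y \<in> X" for y using f that by simp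
  have "is_arg_min ?F ?Q m"
    unfolding is_arg_min_linorder Q using m F by auto
  then have "is_arg_min ?F ?Q (prox_point X f g \<rho>h x)"
    unfolding prox_point_def arg_min_def by (rule someI)
  then show ?thesis
    unfolding is_arg_min_linorder Q using F by auto
qed

text \<open>An exact oracle satisfies the bound with \<open>\<sigma> = 0\<close>, so noisy and exact
  values can be treated together from here on.\<close>

lemma value_oracle_mgf:
  assumes or: "value_oracle g X \<sigma> Q" and x: "x \<in> X"
  shows "(\<integral>\<^sup>+\<omega>. ennreal (exp (\<theta> * (\<omega> - real_of_ereal (g x)))) \<partial>Q x) \<le> ennreal (exp (\<theta>\<^sup>2 * \<sigma>\<^sup>2))"
proof -
  let ?m = "real_of_ereal (g x)"
  interpret prob_space "Q x" using or x by (simp add: value_oracle_def)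
  have int: "integrable (Q x) (\<lambda>\<omega>. \<omega>)" and m: "ereal (\<integral>\<omega>. \<omega> \<partial>Q x) = g x" and \<sigma>: "\<sigma> \<ge> 0"
    using or x by (auto simp: value_oracle_def)
  show ?thesis
  proof (cases "\<sigma> = 0")
    case True
    then have "AE \<omega> in Q x. ereal \<omega> = g x" using or x by (simp add: value_oracle_def)
    then have "AE \<omega> in Q x. ennreal (exp (\<theta> * (\<omega> - ?m))) = 1"
      by eventually_elim (auto simp: m[symmetric])
    then have "(\<integral>\<^sup>+\<omega>. ennreal (exp (\<theta> * (\<omega> - ?m))) \<partial>Q x) = (\<integral>\<^sup>+\<omega>. 1 \<partial>Q x)"
      by (rule nn_integral_cong_AE)
    then show ?thesis using True by (simp add: emeasure_space_1)
  next
    case False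
    then have "(\<integral>\<^sup>+\<omega>. ennreal (exp ((\<omega> - ?m)\<^sup>2 / \<sigma>\<^sup>2)) \<partial>Q x) \<le> ennreal (exp 1)"
      using or x by (simp add: value_oracle_def)
    moreover have "expectation (\<lambda>\<omega>. \<omega> - ?m) = 0"
      using int by (simp add: m[symmetric] prob_space)
    ultimately show ?thesis
      using int \<sigma> False by (intro subgaussian_mgf) auto
  qed
qed

section \<open>Arithmetic of the two step-size regimes\<close>

lemma constant_step_budget:
  fixes A M D L T \<eta> :: real
  assumes "A > 0" "M > 0" "L > 0" "T > 0"
    and T: "T \<ge> 25 * M\<^sup>2 * D\<^sup>2 / (4 * A\<^sup>2)" and \<eta>: "\<eta> = 2 * A / (5 * M\<^sup>2)"
  shows "D\<^sup>2 / 2 + \<eta>\<^sup>2 * M\<^sup>2 * (T + T) / 2 + A * \<eta> * T / 4 < T * (\<eta> * (A - L * (A / (8 * L))))"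
proof -
  have pos: "\<eta> > 0" using assms by simp
  have M2: "\<eta> * M\<^sup>2 = 2 / 5 * A" using assms by simp
  have "25 * M\<^sup>2 * D\<^sup>2 \<le> 4 * A\<^sup>2 * T" using T \<open>A > 0\<close> by (simp add: field_simps)
  also have "\<dots> = 10 * A * T * (\<eta> * M\<^sup>2)" unfolding M2 by (simp add: power2_eq_square)
  finally have "M\<^sup>2 * (25 * D\<^sup>2) \<le> M\<^sup>2 * (10 * (A * \<eta> * T))" by (simp add: mult_ac)
  then have "D\<^sup>2 / 2 \<le> A * \<eta> * T / 5" using \<open>M > 0\<close> by (simp add: mult_ac)
  moreover have "\<eta>\<^sup>2 * M\<^sup>2 * (T + T) / 2 = \<eta> * (\<eta> * M\<^sup>2) * T" by (simp add: power2_eq_square)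
  then have "\<eta>\<^sup>2 * M\<^sup>2 * (T + T) / 2 = 2 / 5 * (A * \<eta> * T)" unfolding M2 by (simp add: mult_ac)
  moreover have "T * (\<eta> * (A - L * (A / (8 * L)))) = 7 / 8 * (A * \<eta> * T)" using \<open>L > 0\<close> by simp
  moreover have "A * \<eta> * T > 0" using assms pos by simp
  \<comment> \<open>In units of \<open>A * \<eta> * T\<close>, the diameter takes 1/5, the squares
    2/5 and the noise 1/4, together 17/20; the mini-batch error leaves 7/8 on the right.\<close>
  ultimately show ?thesis by linarith
qed

lemma inverse_sum_upper_half:
  assumes "T > 0"
  shows "1 / 2 \<le> (\<Sum>t=T div 2..<T. 1 / (real t + 1))"
proof -
  have "real T \<le> 2 * real (T - T div 2)" by linarith
  then have "1 / 2 \<le> real (T - T div 2) * (1 / real T)" using assms by (simp add: field_simps)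
  also have "\<dots> = (\<Sum>t=T div 2..<T. 1 / real T)" by simp
  also have "\<dots> \<le> (\<Sum>t=T div 2..<T. 1 / (real t + 1))"
    by (intro sum_mono divide_left_mono mult_pos_pos) auto
  finally show ?thesis .
qed

text \<open>The form in which \<open>E\<close> is used: 3 units pay for the mini-batch error, and
  \<open>E - 3\<close> must beat
  \<open>2 + ln (8 / \<delta>) + 8 * sqrt (ln (4 / \<delta>))\<close>, which comes from diameter,
  squares and noise. The factor \<open>2 * pi / sqrt 6\<close> is at least 1.\<close>

lemma decreasing_step_constant:
  assumes "0 < \<delta>" "\<delta> < 1"
    and E: "E \<ge> 8 + 2 * pi / sqrt 6 * max (sqrt (12 * ln (8 / \<delta>))) (4 / 3 * ln (8 / \<delta>)) + 8 * sqrt (3 * ln (4 / \<delta>))"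
  shows "E > 5 + ln (8 / \<delta>) + 8 * sqrt (ln (4 / \<delta>))"
proof -
  have l: "ln (8 / \<delta>) > 0" "ln (4 / \<delta>) > 0" using assms by simp_all
  have "sqrt 6 \<le> 3" by (rule real_le_lsqrt) auto
  then have "1 \<le> 2 * pi / sqrt 6" using pi_gt3 by (simp add: field_simps)
  then have "1 * ln (8 / \<delta>) \<le> 2 * pi / sqrt 6 * max (sqrt (12 * ln (8 / \<delta>))) (4 / 3 * ln (8 / \<delta>))"
    using l by (intro mult_mono) auto
  moreover have "sqrt (ln (4 / \<delta>)) \<le> sqrt (3 * ln (4 / \<delta>))" using l by simp
  ultimately show ?thesis using E by linarith
qed

text \<open>Here \<open>s\<close> stands for \<open>t + 1\<close>. The mini-batch error decays with
  \<open>sqrt T\<close> rather than \<open>sqrt s\<close>; since \<open>s \<le> T\<close>, it costs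
  at most 3 of the \<open>E\<close> units.\<close>

lemma decreasing_step_term:
  fixes E M D L s T :: real
  assumes "M > 0" "D > 0" "L > 0" "0 < s" "s \<le> T"
  shows "D / (M * sqrt s) * (E * M * D / sqrt s - L * (3 * M * D / (sqrt T * L))) \<ge> (E - 3) * D\<^sup>2 * (1 / s)"
proof -
  have "s \<le> sqrt s * sqrt T"
    using assms real_sqrt_le_mono[of s T] mult_left_mono[of "sqrt s" "sqrt T" "sqrt s"] by simp
  then have "3 * D\<^sup>2 / (sqrt s * sqrt T) \<le> 3 * D\<^sup>2 / s"
    using assms by (intro divide_left_mono mult_pos_pos) auto
  moreover have "D / (M * sqrt s) * (E * M * D / sqrt s - L * (3 * M * D / (sqrt T * L))) =
      E * D\<^sup>2 / s - 3 * D\<^sup>2 / (sqrt s * sqrt T)"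
    using assms by (simp add: right_diff_distrib power2_eq_square mult_ac)
  moreover have "(E - 3) * D\<^sup>2 * (1 / s) = E * D\<^sup>2 / s - 3 * D\<^sup>2 / s"
    by (simp add: left_diff_distrib diff_divide_distrib)
  ultimately show ?thesis by linarith
qed

section \<open>Choice of the parameters in the two cases\<close>

theorem theoremA14:
  fixes X :: "'a::euclidean_space set" and f g :: "'a \<Rightarrow> ereal"
    and M D \<rho> \<rho>h \<sigma> \<epsilon> \<delta> Lam E :: real
    and x_feas x0 :: 'a
    and Q :: "'a \<Rightarrow> real measure" and Pf Pg :: "'a \<Rightarrow> 'a measure"
    and T B S :: nat and tol \<eta> :: "nat \<Rightarrow> real"
    and \<Omega> :: "'w measure" and Z :: "nat \<Rightarrow> 'w \<Rightarrow> 'a outputs"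
  assumes "closed X" "convex X"
    and "\<And>x. f x \<noteq> -\<infinity>" "\<And>x. g x \<noteq> -\<infinity>"
    and "continuous_on X f" "continuous_on X g"
    and "\<And>x. x \<in> X \<Longrightarrow> subdiff f x \<noteq> {}" "\<And>x. x \<in> X \<Longrightarrow> subdiff g x \<noteq> {}"
    and "M > 0"
    and "\<And>x \<zeta>. x \<in> X \<Longrightarrow> \<zeta> \<in> subdiff f x \<Longrightarrow> norm \<zeta> \<le> M"
    and "\<And>x \<zeta>. x \<in> X \<Longrightarrow> \<zeta> \<in> subdiff g x \<Longrightarrow> norm \<zeta> \<le> M"
    and "\<rho> \<ge> 0" "weakly_convex_on \<rho> X f" "weakly_convex_on 0 X g"
    and "x_feas \<in> rel_interior X" "g x_feas < 0"
    and "D > 0" "\<And>x x'. x \<in> X \<Longrightarrow> x' \<in> X \<Longrightarrow> norm (x - x') \<le> D"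
    and "value_oracle g X \<sigma> Q" "subgradient_oracle f X M Pf" "subgradient_oracle g X M Pg"
    and "\<rho>h > \<rho>"
    and "Lam = (M * D + \<rho>h * D\<^sup>2) / (- real_of_ereal (g x_feas))"
    and "\<epsilon> > 0" "0 < \<delta>" "\<delta> < 1"
    and "T > 0"
    and "switching_run \<Omega> X T B tol \<eta> x0 Q Pf Pg Z"
    and cases:
      "(S = 0 \<and>
        (\<forall>t. tol t = \<epsilon>\<^sup>2 * (\<rho>h - \<rho>) / (1 + Lam)) \<and>
        (\<forall>t. \<eta> t = 2 * \<epsilon>\<^sup>2 * (\<rho>h - \<rho>) / (5 * (1 + Lam) * M\<^sup>2)) \<and>
        real T \<ge> 25 * M\<^sup>2 * D\<^sup>2 * (1 + Lam)\<^sup>2 / (4 * \<epsilon>^4 * (\<rho>h - \<rho>)\<^sup>2) \<and>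
        real T \<ge> max (12 * ln (8 / \<delta>)) (16 / 9 * (ln (8 / \<delta>))\<^sup>2) \<and>
        real T \<ge> 300 * ln (4 / \<delta>) * M\<^sup>2 * D\<^sup>2 * (1 + Lam)\<^sup>2 / (\<epsilon>^4 * (\<rho>h - \<rho>)\<^sup>2) \<and>
        B = max 1 (nat \<lceil>300 * \<sigma>\<^sup>2 * ln (4 * real T / \<delta>) * (1 + Lam)^4 / (\<epsilon>^4 * (\<rho>h - \<rho>)\<^sup>2)\<rceil>))
       \<or>
       (S = T div 2 \<and>
        (\<forall>t. \<eta> t = D / (M * sqrt (real t + 1))) \<and>
        (\<forall>t. tol t = E * M * D / sqrt (real t + 1)) \<and>
        E > 0 \<and>
        E \<ge> 8 + 2 * pi / sqrt 6 * max (sqrt (12 * ln (8 / \<delta>))) (4 / 3 * ln (8 / \<delta>))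
              + 8 * sqrt (3 * ln (4 / \<delta>)) \<and>
        real T \<ge> 2 * E\<^sup>2 * M\<^sup>2 * D\<^sup>2 * (1 + Lam)\<^sup>2 / (\<epsilon>^4 * (\<rho>h - \<rho>)\<^sup>2) \<and>
        B = max 1 (nat \<lceil>3 * real T * \<sigma>\<^sup>2 * ln (2 * real T / \<delta>) * (1 + Lam)\<^sup>2 / (2 * M\<^sup>2 * D\<^sup>2)\<rceil>))"
  shows "measure \<Omega> {w \<in> space \<Omega>.
      let x = iterate X B tol \<eta> x0 (\<lambda>s. Z s w);
          I = index_set S T B tol (\<lambda>s. Z s w)
      in I \<noteq> {} \<and>
         measure_pmf.expectation (tau_pmf \<eta> I) (\<lambda>t. norm (prox_point X f g \<rho>h (x t) - x t)) \<le> \<epsilon> \<and>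
         measure_pmf.expectation (tau_pmf \<eta> I) (\<lambda>t. real_of_ereal (g (x t)))
           \<le> 2 * \<epsilon>\<^sup>2 * (\<rho>h - \<rho>) / (1 + Lam)}
    \<ge> 1 - \<delta>"

proof -
  define fr where "fr x = real_of_ereal (f x)" for x
  define gr where "gr x = real_of_ereal (g x)" for x
  define p where "p = prox_point X f g \<rho>h"
  define A where "A = \<epsilon>\<^sup>2 * (\<rho>h - \<rho>) / (1 + Lam)"
  have f: "f x = ereal (fr x)" if "x \<in> X" for x
  proof -
    have "\<bar>f x\<bar> \<noteq> \<infinity>"
      by (rule subdiff_bounded_imp_finite[OF assms(3) assms(7)[OF that] assms(10)[OF that]])
    then show ?thesis by (simp add: fr_def ereal_real)
  qed
  have g: "g x = ereal (gr x)" if "x \<in> X" for x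
  proof -
    have "\<bar>g x\<bar> \<noteq> \<infinity>"
      by (rule subdiff_bounded_imp_finite[OF assms(4) assms(8)[OF that] assms(11)[OF that]])
    then show ?thesis by (simp add: gr_def ereal_real)
  qed
  have "continuous_on X (real_of_ereal \<circ> f)"
    by (rule continuous_on_iff_real[THEN iffD1, OF _ assms(5)]) (simp add: f)
  moreover have "continuous_on X (real_of_ereal \<circ> g)"
    by (rule continuous_on_iff_real[THEN iffD1, OF _ assms(6)]) (simp add: g)
  ultimately have cf: "continuous_on X fr" and cg: "continuous_on X gr"
    by (simp_all add: fr_def[abs_def] gr_def[abs_def] comp_def)
  have xf: "x_feas \<in> X" using assms(15) rel_interior_subset by blast
  have gxf: "gr x_feas < 0" using assms(16) g[OF xf] by simp
  have wf: "fr y \<ge> fr x + \<zeta> \<bullet> (y - x) - \<rho> / 2 * (norm (y - x))\<^sup>2" if "x \<in> X" "y \<in> X" "\<zeta> \<in> subdiff f x" for x y \<zeta>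
  proof -
    have "f y \<ge> f x + ereal (\<zeta> \<bullet> (y - x) - \<rho> / 2 * (norm (y - x))\<^sup>2)"
      using assms(13) that unfolding weakly_convex_on_def by blast
    then show ?thesis using that f by (simp add: add_diff_eq)
  qed
  have wg: "gr y \<ge> gr x + \<zeta> \<bullet> (y - x)" if "x \<in> X" "y \<in> X" "\<zeta> \<in> subdiff g x" for x y \<zeta>
  proof -
    have "g y \<ge> g x + ereal (\<zeta> \<bullet> (y - x) - 0 / 2 * (norm (y - x))\<^sup>2)"
      using assms(14) that unfolding weakly_convex_on_def by blast
    then show ?thesis using that g by simp
  qed
  have prox: "p x \<in> X \<and> gr (p x) \<le> 0 \<and> (\<forall>y\<in>X. gr y \<le> 0 \<longrightarrow>
      fr (p x) + \<rho>h / 2 * (norm (p x - x))\<^sup>2 \<le> fr y + \<rho>h / 2 * (norm (y - x))\<^sup>2)" for x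
    unfolding p_def
  proof (rule prox_point_minimizes)
    show "compact X" using assms(1) assms(18) by (intro compact_if_diam_bounded)
  qed (use f g cf cg xf gxf in auto)
  have opt: "constrained_prox X fr gr p M D \<rho> \<rho>h Lam x_feas"
  proof
    fix x' assume x': "x' \<in> X"
    obtain \<zeta> where "\<zeta> \<in> subdiff f x'" using assms(7)[OF x'] by blast
    then show "\<exists>\<zeta>. norm \<zeta> \<le> M \<and> (\<forall>x\<in>X. fr x \<ge> fr x' + \<zeta> \<bullet> (x - x') - \<rho> / 2 * (norm (x - x'))\<^sup>2)"
      using wf[OF x'] assms(10)[OF x'] by blast
    obtain \<zeta> where "\<zeta> \<in> subdiff g x'" using assms(8)[OF x'] by blast
    then show "\<exists>\<zeta>. \<forall>x\<in>X. gr x \<ge> gr x' + \<zeta> \<bullet> (x - x')"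
      using wg[OF x'] by blast
  qed (use assms(1,2,9,12,17,18,22,23) xf gxf prox in \<open>auto simp: gr_def\<close>)
  then interpret opt: constrained_prox X fr gr p M D \<rho> \<rho>h Lam x_feas .
  have A: "(1 + Lam) * A = \<epsilon>\<^sup>2 * (\<rho>h - \<rho>)" and A0: "A > 0"
    using opt.Lam_pos assms(22) \<open>\<epsilon> > 0\<close> by (simp_all add: A_def)
  have B: "B > 0" using cases by auto
  have run: "switching_process \<Omega> X T B tol \<eta> x0 Q Pf Pg Z"
    unfolding switching_process_def switching_process_axioms_def
    using assms(1,2,19-21) B \<open>switching_run \<Omega> X T B tol \<eta> x0 Q Pf Pg Z\<close>
    by (auto simp: switching_run_def value_oracle_def subgradient_oracle_def)
  have eq: "2 * \<epsilon>\<^sup>2 * (\<rho>h - \<rho>) / (1 + Lam) = 2 * A" by (simp add: A_def)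
  have tgt: ?thesis
    if "S \<le> T" "\<And>t. \<eta> t > 0"
    "\<And>t. S \<le> t \<Longrightarrow> t < T \<Longrightarrow> 0 \<le> tol t \<and> tol t \<le> A"
    "0 < r" "r \<le> A" "0 < l1" "4 * \<sigma>\<^sup>2 * l1 \<le> real B * r\<^sup>2"
    "0 \<le> W" "\<And>t. S \<le> t \<Longrightarrow> t < T \<Longrightarrow> (\<eta> t)\<^sup>2 * M\<^sup>2 \<le> W" "W * (real (T - S) + u) \<le> V"
    "0 < N" "0 < l2" "4 * ((2 * M * D)\<^sup>2 * (\<Sum>t=S..<T. (\<eta> t)\<^sup>2)) * l2 \<le> N\<^sup>2"
    "D\<^sup>2 / 2 + V / 2 + N < (\<Sum>t=S..<T. \<eta> t * (tol t - (1 + Lam) * r))"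
    "real (T - S) * (2 * exp (- l1)) + exp (- u) + exp (- l2) \<le> \<delta>"
    for r l1 W u V N l2
    unfolding eq p_def[symmetric] gr_def[symmetric]
  proof (rule switching_guarantee[OF opt run cg _ _ _ _ _ that(1,2) \<open>\<epsilon> > 0\<close> A that(3-)])
    fix x assume x: "x \<in> X"
    show "(\<integral>\<^sup>+\<omega>. ennreal (exp (\<theta> * (\<omega> - gr x))) \<partial>Q x) \<le> ennreal (exp (\<theta>\<^sup>2 * \<sigma>\<^sup>2))" for \<theta>
      using value_oracle_mgf[OF assms(19) x] by (simp add: gr_def)
    show "(\<integral>\<^sup>+\<xi>. ennreal (exp ((norm \<xi>)\<^sup>2 / M\<^sup>2)) \<partial>Pf x) \<le> ennreal (exp 1)"
      "(\<integral>\<^sup>+\<xi>. ennreal (exp ((norm \<xi>)\<^sup>2 / M\<^sup>2)) \<partial>Pg x) \<le> ennreal (exp 1)"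
      using assms(20,21) x by (auto simp: subgradient_oracle_def)
    have "integrable (Pf x) (\<lambda>\<xi>. \<xi>) \<and> (\<integral>\<xi>. \<xi> \<partial>Pf x) \<in> subdiff f x"
      "integrable (Pg x) (\<lambda>\<xi>. \<xi>) \<and> (\<integral>\<xi>. \<xi> \<partial>Pg x) \<in> subdiff g x"
      using assms(20,21) x by (auto simp: subgradient_oracle_def)
    then show "integrable (Pf x) (\<lambda>\<xi>. \<xi>) \<and> norm (\<integral>\<xi>. \<xi> \<partial>Pf x) \<le> M \<and>
        (\<forall>y\<in>X. fr y \<ge> fr x + (\<integral>\<xi>. \<xi> \<partial>Pf x) \<bullet> (y - x) - \<rho> / 2 * (norm (y - x))\<^sup>2)"
      "integrable (Pg x) (\<lambda>\<xi>. \<xi>) \<and> norm (\<integral>\<xi>. \<xi> \<partial>Pg x) \<le> M \<and>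
        (\<forall>y\<in>X. gr y \<ge> gr x + (\<integral>\<xi>. \<xi> \<partial>Pg x) \<bullet> (y - x))"
      using wf[OF x] wg[OF x] assms(10,11)[OF x] by auto
  qed
  let ?L = "1 + Lam"
  have L: "?L > 1" using opt.Lam_pos by simp
  have T: "real T > 0" using \<open>T > 0\<close> by simp
  \<comment> \<open>Expresses the thresholds on \<open>T\<close> and \<open>B\<close> through
    \<open>A\<close>, where the powers of \<open>1 + Lam\<close> largely cancel.\<close>
  have q: "\<epsilon>^4 * (\<rho>h - \<rho>)\<^sup>2 = A\<^sup>2 * ?L\<^sup>2"
    using arg_cong[OF A, of power2] by (simp add: power_mult_distrib mult.commute flip: power_mult)
  have l: "ln (8 / \<delta>) > 0" "ln (4 / \<delta>) > 0" "ln (4 * real T / \<delta>) > 0" "ln (2 * real T / \<delta>) > 0"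
    using \<open>0 < \<delta>\<close> \<open>\<delta> < 1\<close> \<open>T > 0\<close> by simp_all
  note M = \<open>M > 0\<close> and D = \<open>D > 0\<close>
  show ?thesis using cases
  proof (elim disjE conjE)
    assume S: "S = 0" and tol: "\<forall>t. tol t = \<epsilon>\<^sup>2 * (\<rho>h - \<rho>) / (1 + Lam)"
      and \<eta>: "\<forall>t. \<eta> t = 2 * \<epsilon>\<^sup>2 * (\<rho>h - \<rho>) / (5 * (1 + Lam) * M\<^sup>2)"
      and T1: "real T \<ge> 25 * M\<^sup>2 * D\<^sup>2 * (1 + Lam)\<^sup>2 / (4 * \<epsilon>^4 * (\<rho>h - \<rho>)\<^sup>2)"
      and T2: "real T \<ge> max (12 * ln (8 / \<delta>)) (16 / 9 * (ln (8 / \<delta>))\<^sup>2)"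
      and T3: "real T \<ge> 300 * ln (4 / \<delta>) * M\<^sup>2 * D\<^sup>2 * (1 + Lam)\<^sup>2 / (\<epsilon>^4 * (\<rho>h - \<rho>)\<^sup>2)"
      and Bdef: "B = max 1 (nat \<lceil>300 * \<sigma>\<^sup>2 * ln (4 * real T / \<delta>) * (1 + Lam)^4 / (\<epsilon>^4 * (\<rho>h - \<rho>)\<^sup>2)\<rceil>)"
    define e where "e = 2 * A / (5 * M\<^sup>2)"
    have tol': "tol t = A" and \<eta>': "\<eta> t = e" for t
      using tol \<eta> by (simp_all add: A_def e_def mult_ac)
    have e: "e > 0" using A0 M by (simp add: e_def)
    have T1': "real T \<ge> 25 * M\<^sup>2 * D\<^sup>2 / (4 * A\<^sup>2)"
      using T1 L A0 unfolding mult.assoc q by (simp add: field_simps)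
    have T3': "300 * (M\<^sup>2 * D\<^sup>2 * ln (4 / \<delta>)) \<le> A\<^sup>2 * real T"
      using T3 L A0 unfolding mult.assoc q by (simp add: field_simps)
    have "300 * \<sigma>\<^sup>2 * ln (4 * real T / \<delta>) * ?L^4 / (\<epsilon>^4 * (\<rho>h - \<rho>)\<^sup>2) \<le> real B"
      unfolding Bdef by linarith
    also have "300 * \<sigma>\<^sup>2 * ln (4 * real T / \<delta>) * ?L^4 / (\<epsilon>^4 * (\<rho>h - \<rho>)\<^sup>2) =
        (300 * \<sigma>\<^sup>2 * ln (4 * real T / \<delta>) * ?L\<^sup>2) * ?L\<^sup>2 / (A\<^sup>2 * ?L\<^sup>2)"
      unfolding q by (simp add: mult.assoc flip: power_add)
    also have "\<dots> = 300 * \<sigma>\<^sup>2 * ln (4 * real T / \<delta>) * ?L\<^sup>2 / A\<^sup>2"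
      using L by simp
    finally have B1: "300 * \<sigma>\<^sup>2 * ln (4 * real T / \<delta>) * ?L\<^sup>2 \<le> real B * A\<^sup>2"
      using A0 by (simp add: pos_divide_le_eq)
    show ?thesis
    \<comment> \<open>The failure probabilities are at most \<open>\<delta> / 2\<close> for the
      batches, \<open>\<delta> / 8\<close> for the squares and \<open>\<delta> / 4\<close> for the
      noise. Taking \<open>u = real T\<close> merely doubles the typical sum of squares.\<close>
    proof (rule tgt[where r="A / (8 * ?L)" and ?l1.0="ln (4 * real T / \<delta>)" and W="e\<^sup>2 * M\<^sup>2" and u="real T"
          and V="e\<^sup>2 * M\<^sup>2 * (real T + real T)" and N="A * e * real T / 4" and ?l2.0="ln (4 / \<delta>)"])
      show "4 * \<sigma>\<^sup>2 * ln (4 * real T / \<delta>) \<le> real B * (A / (8 * ?L))\<^sup>2"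
      proof -
        have "0 \<le> \<sigma>\<^sup>2 * ln (4 * real T / \<delta>)" using l by simp
        then have "4 * \<sigma>\<^sup>2 * ln (4 * real T / \<delta>) \<le> 300 * \<sigma>\<^sup>2 * ln (4 * real T / \<delta>) * ?L\<^sup>2 / (64 * ?L\<^sup>2)"
          using L by simp
        also have "\<dots> \<le> real B * A\<^sup>2 / (64 * ?L\<^sup>2)" using B1 by (intro divide_right_mono) auto
        also have "\<dots> = real B * (A / (8 * ?L))\<^sup>2" unfolding power_divide power_mult_distrib by simp
        finally show ?thesis .
      qed
      show "4 * ((2 * M * D)\<^sup>2 * (\<Sum>t=S..<T. (\<eta> t)\<^sup>2)) * ln (4 / \<delta>) \<le> (A * e * real T / 4)\<^sup>2"
      proof -
        have "0 \<le> M\<^sup>2 * D\<^sup>2 * ln (4 / \<delta>)" using l by simp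
        \<comment> \<open>Sixteen is 4 times the square of the factor 2 in \<open>2 * M * D\<close>,
          and 1/16 comes from squaring the quarter in \<open>N\<close>; so 256 is needed and 300 is
          available.\<close>
        then have "16 * (M\<^sup>2 * D\<^sup>2 * ln (4 / \<delta>)) \<le> A\<^sup>2 * real T / 16" using T3' by linarith
        then have "16 * (M\<^sup>2 * D\<^sup>2 * ln (4 / \<delta>)) * (real T * e\<^sup>2) \<le> A\<^sup>2 * real T / 16 * (real T * e\<^sup>2)"
          by (intro mult_right_mono) auto
        then show ?thesis by (simp add: S \<eta>' power_mult_distrib power_divide power2_eq_square mult_ac)
      qed
      show "D\<^sup>2 / 2 + e\<^sup>2 * M\<^sup>2 * (real T + real T) / 2 + A * e * real T / 4 <
          (\<Sum>t=S..<T. \<eta> t * (tol t - ?L * (A / (8 * ?L))))"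
        using constant_step_budget[OF A0 M _ T T1' e_def, of ?L] L by (simp add: S \<eta>' tol')
      have "exp (- real T) \<le> exp (- ln (8 / \<delta>))" using T2 l by simp
      also have "\<dots> = \<delta> / 8" using \<open>0 < \<delta>\<close> by (simp add: exp_minus)
      finally have "exp (- real T) \<le> \<delta> / 8" .
      moreover have "exp (- ln (4 / \<delta>)) = \<delta> / 4" "exp (- ln (4 * real T / \<delta>)) = \<delta> / (4 * real T)"
        using \<open>0 < \<delta>\<close> T by (simp_all add: exp_minus)
      ultimately show "real (T - S) * (2 * exp (- ln (4 * real T / \<delta>))) + exp (- real T) + exp (- ln (4 / \<delta>)) \<le> \<delta>"
        using T \<open>0 < \<delta>\<close> by (simp add: S)
      show "A / (8 * ?L) \<le> A" using A0 L by (simp add: divide_le_eq)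
    qed (use A0 L e l T S \<eta>' tol' in auto)
  next
    assume S: "S = T div 2" and \<eta>: "\<forall>t. \<eta> t = D / (M * sqrt (real t + 1))"
      and tol: "\<forall>t. tol t = E * M * D / sqrt (real t + 1)" and "E > 0"
      and E: "E \<ge> 8 + 2 * pi / sqrt 6 * max (sqrt (12 * ln (8 / \<delta>))) (4 / 3 * ln (8 / \<delta>)) + 8 * sqrt (3 * ln (4 / \<delta>))"
      and T1: "real T \<ge> 2 * E\<^sup>2 * M\<^sup>2 * D\<^sup>2 * (1 + Lam)\<^sup>2 / (\<epsilon>^4 * (\<rho>h - \<rho>)\<^sup>2)"
      and Bdef: "B = max 1 (nat \<lceil>3 * real T * \<sigma>\<^sup>2 * ln (2 * real T / \<delta>) * (1 + Lam)\<^sup>2 / (2 * M\<^sup>2 * D\<^sup>2)\<rceil>)"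
    let ?u = "ln (8 / \<delta>)" and ?l = "ln (4 / \<delta>)"
    define H where "H = (\<Sum>t=S..<T. 1 / (real t + 1))"
    have H: "H \<ge> 1 / 2" unfolding H_def S by (rule inverse_sum_upper_half[OF \<open>T > 0\<close>])
    have E5: "E > 5 + ?u + 8 * sqrt ?l" by (rule decreasing_step_constant[OF \<open>0 < \<delta>\<close> \<open>\<delta> < 1\<close> E])
    then have E5': "E > 5" using l real_sqrt_ge_zero[of ?l] by linarith
    have T1': "2 * (E * M * D)\<^sup>2 \<le> A\<^sup>2 * real T"
      using T1 L A0 unfolding q by (simp add: field_simps power_mult_distrib)
    have "3 * real T * \<sigma>\<^sup>2 * ln (2 * real T / \<delta>) * ?L\<^sup>2 / (2 * M\<^sup>2 * D\<^sup>2) \<le> real B"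
      unfolding Bdef by linarith
    then have B1: "3 * real T * \<sigma>\<^sup>2 * ln (2 * real T / \<delta>) * ?L\<^sup>2 \<le> real B * (2 * M\<^sup>2 * D\<^sup>2)"
      using M D by (simp add: pos_divide_le_eq)
    have \<eta>2: "(\<eta> t)\<^sup>2 = D\<^sup>2 / M\<^sup>2 * (1 / (real t + 1))" for t
      using \<eta> by (simp add: power_divide power_mult_distrib)
    show ?thesis
    \<comment> \<open>The stated \<open>B\<close> has room for twice the logarithm in
      \<open>l1\<close>: with a single one, the bound \<open>real T * 2 * exp (- l1)\<close> would
      already equal \<open>\<delta>\<close>. Now the batches fail with probability at most
      \<open>\<delta>\<^sup>2 / 2\<close>, and squares and noise with at most
      \<open>\<delta> / 8\<close> and \<open>\<delta>\<^sup>2 / 16\<close>.\<close>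
    proof (rule tgt[where r="3 * M * D / (sqrt (real T) * ?L)" and ?l1.0="2 * ln (2 * real T / \<delta>)"
          and W="D\<^sup>2 / (real S + 1)" and u="?u" and V="D\<^sup>2 * (1 + ?u)" and N="8 * D\<^sup>2 * H * sqrt ?l" and ?l2.0="2 * ?l"])
      show "S \<le> T" by (simp add: S)
      show "\<eta> t > 0" for t using \<eta> M D by (simp add: add_pos_nonneg)
      fix t assume t: "S \<le> t" "t < T"
      \<comment> \<open>From \<open>S\<close> on, \<open>t + 1\<close> is at least half of
        \<open>T\<close>, also for odd \<open>T\<close>, where \<open>T div 2\<close> rounds down.
        Hence the lower bound on \<open>T\<close> brings these tolerances below
        \<open>A\<close>.\<close>
      have "T \<le> 2 * (t + 1)" using t(1) unfolding S by presburger
      then have "real T \<le> real (2 * (t + 1))" by (simp only: of_nat_le_iff)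
      then have "real T \<le> 2 * (real t + 1)" by simp
      then have "2 * (E * M * D)\<^sup>2 \<le> A\<^sup>2 * (2 * (real t + 1))"
        by (intro order.trans[OF T1'] mult_left_mono) auto
      then have "(E * M * D)\<^sup>2 \<le> A\<^sup>2 * (real t + 1)" by (simp add: algebra_simps)
      then have "(E * M * D)\<^sup>2 \<le> (A * sqrt (real t + 1))\<^sup>2" by (simp add: power_mult_distrib)
      then have "E * M * D \<le> A * sqrt (real t + 1)"
        by (rule power2_le_imp_le) (use A0 in simp)
      then show "0 \<le> tol t \<and> tol t \<le> A"
        using tol \<open>E > 0\<close> M D by (simp add: pos_divide_le_eq add_pos_nonneg)
      show "(\<eta> t)\<^sup>2 * M\<^sup>2 \<le> D\<^sup>2 / (real S + 1)"
        using t M by (simp add: \<eta>2) (intro divide_left_mono, auto)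
    next
      show "0 < 3 * M * D / (sqrt (real T) * ?L)" using M D T L by simp
      have "(3 * M * D)\<^sup>2 \<le> (E * M * D)\<^sup>2"
        using E5' M D by (intro power_mono mult_right_mono) auto
      then have "(3 * M * D)\<^sup>2 \<le> A\<^sup>2 * real T" using T1' by (smt (verit) zero_le_power2)
      then have "(3 * M * D)\<^sup>2 \<le> (A * sqrt (real T))\<^sup>2" by (simp add: power_mult_distrib)
      then have "3 * M * D \<le> A * sqrt (real T)"
        by (rule power2_le_imp_le) (use A0 in simp)
      also have "\<dots> \<le> A * sqrt (real T) * ?L"
        using mult_left_mono[of 1 ?L "A * sqrt (real T)"] A0 L by simp
      finally show "3 * M * D / (sqrt (real T) * ?L) \<le> A"
        using T L by (simp add: pos_divide_le_eq mult_ac)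
      show "4 * \<sigma>\<^sup>2 * (2 * ln (2 * real T / \<delta>)) \<le> real B * (3 * M * D / (sqrt (real T) * ?L))\<^sup>2"
      proof -
        have "0 \<le> \<sigma>\<^sup>2 * ln (2 * real T / \<delta>)" using l by simp
        then have "4 * \<sigma>\<^sup>2 * (2 * ln (2 * real T / \<delta>)) \<le>
            9 / 2 * (3 * real T * \<sigma>\<^sup>2 * ln (2 * real T / \<delta>) * ?L\<^sup>2) / (real T * ?L\<^sup>2)"
          using L T by simp
        also have "\<dots> \<le> 9 / 2 * (real B * (2 * M\<^sup>2 * D\<^sup>2)) / (real T * ?L\<^sup>2)"
          using B1 by (intro divide_right_mono mult_left_mono) auto
        finally show ?thesis by (simp add: power_divide power_mult_distrib mult_ac)
      qed
      show "0 \<le> D\<^sup>2 / (real S + 1)" by simp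
      have "real (T - S) + ?u \<le> (real S + 1) * (1 + ?u)"
      proof -
        have "real (T - S) \<le> real S + 1" unfolding S by linarith
        moreover have "?u \<le> (real S + 1) * ?u" using l by (simp add: distrib_right)
        ultimately show ?thesis by (simp add: distrib_left)
      qed
      then have "D\<^sup>2 * (real (T - S) + ?u) \<le> D\<^sup>2 * ((real S + 1) * (1 + ?u))"
        by (intro mult_left_mono) auto
      then show "D\<^sup>2 / (real S + 1) * (real (T - S) + ?u) \<le> D\<^sup>2 * (1 + ?u)"
        by (simp add: pos_divide_le_eq mult_ac)
      show "0 < 8 * D\<^sup>2 * H * sqrt ?l" using D H l by simp
      have "(\<Sum>t=S..<T. (\<eta> t)\<^sup>2) = D\<^sup>2 / M\<^sup>2 * H"
        unfolding \<eta>2 H_def by (rule sum_distrib_left[symmetric])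
      then have "4 * ((2 * M * D)\<^sup>2 * (\<Sum>t=S..<T. (\<eta> t)\<^sup>2)) * (2 * ?l) = 32 * (D\<^sup>2)\<^sup>2 * ?l * H"
        using M by (simp add: power_mult_distrib power2_eq_square)
      \<comment> \<open>\<open>H \<ge> 1 / 2\<close> gives \<open>H \<le> 2 * H * H\<close>, so
        \<open>N\<close> can be proportional to \<open>H\<close>, like the gain it is compared with;
        64 is the square of the 8 in \<open>N\<close>.\<close>
      also have "\<dots> \<le> 32 * (D\<^sup>2)\<^sup>2 * ?l * (2 * H * H)"
        using H l by (intro mult_left_mono) auto
      also have "\<dots> = (8 * D\<^sup>2 * H * sqrt ?l)\<^sup>2"
        using l by (simp add: power_mult_distrib) (simp add: power2_eq_square)
      finally show "4 * ((2 * M * D)\<^sup>2 * (\<Sum>t=S..<T. (\<eta> t)\<^sup>2)) * (2 * ?l) \<le> (8 * D\<^sup>2 * H * sqrt ?l)\<^sup>2" .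
      have "D\<^sup>2 / 2 + D\<^sup>2 * (1 + ?u) / 2 + 8 * D\<^sup>2 * H * sqrt ?l = D\<^sup>2 * (1 / 2 * (2 + ?u) + H * (8 * sqrt ?l))"
        by (simp add: field_simps)
      \<comment> \<open>Again \<open>H \<ge> 1 / 2\<close>: after this every term carries the factor
        \<open>H\<close>, and the claim is an inequality for \<open>E\<close> alone.\<close>
      also have "\<dots> \<le> D\<^sup>2 * (H * (2 + ?u) + H * (8 * sqrt ?l))"
        using H l by (intro mult_left_mono add_right_mono mult_right_mono) auto
      also have "\<dots> = D\<^sup>2 * (H * (2 + ?u + 8 * sqrt ?l))" by (simp add: distrib_left)
      also have "\<dots> < D\<^sup>2 * (H * (E - 3))"
        using H D E5 by (intro mult_strict_left_mono) auto
      also have "\<dots> = (\<Sum>t=S..<T. (E - 3) * D\<^sup>2 * (1 / (real t + 1)))"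
        unfolding H_def by (simp add: sum_distrib_left mult_ac)
      also have "\<dots> \<le> (\<Sum>t=S..<T. \<eta> t * (tol t - ?L * (3 * M * D / (sqrt (real T) * ?L))))"
      proof (rule sum_mono)
        fix t assume "t \<in> {S..<T}"
        then show "(E - 3) * D\<^sup>2 * (1 / (real t + 1)) \<le> \<eta> t * (tol t - ?L * (3 * M * D / (sqrt (real T) * ?L)))"
          unfolding \<eta>[rule_format] tol[rule_format] using L
          by (intro decreasing_step_term M D) auto
      qed
      finally show "D\<^sup>2 / 2 + D\<^sup>2 * (1 + ?u) / 2 + 8 * D\<^sup>2 * H * sqrt ?l <
          (\<Sum>t=S..<T. \<eta> t * (tol t - ?L * (3 * M * D / (sqrt (real T) * ?L))))" .
      have ex: "exp (- (2 * ln y)) = 1 / y\<^sup>2" if "y > 0" for y :: real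
        using that by (simp add: exp_minus exp_double divide_inverse)
      have "real (T - S) * (2 * exp (- (2 * ln (2 * real T / \<delta>)))) \<le> real T * (2 * exp (- (2 * ln (2 * real T / \<delta>))))"
        by (intro mult_right_mono) auto
      also have "\<dots> = real T * (2 * (\<delta>\<^sup>2 / (4 * (real T)\<^sup>2)))"
        using \<open>0 < \<delta>\<close> T by (subst ex) (auto simp: power_divide power_mult_distrib)
      also have "\<dots> = \<delta>\<^sup>2 / (2 * real T)" using T by (simp add: power2_eq_square)
      also have "\<dots> \<le> \<delta>\<^sup>2 / 2" using \<open>T > 0\<close> by (intro divide_left_mono) auto
      finally have "real (T - S) * (2 * exp (- (2 * ln (2 * real T / \<delta>)))) \<le> \<delta>\<^sup>2 / 2" .
      moreover have "exp (- (2 * ?l)) = \<delta>\<^sup>2 / 16" "exp (- ?u) = \<delta> / 8"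
        using \<open>0 < \<delta>\<close> ex[of "4 / \<delta>"] by (simp_all add: power_divide exp_minus)
      moreover have "\<delta>\<^sup>2 \<le> \<delta>" using \<open>0 < \<delta>\<close> \<open>\<delta> < 1\<close> by (simp add: power2_eq_square mult_left_le)
      ultimately show "real (T - S) * (2 * exp (- (2 * ln (2 * real T / \<delta>)))) + exp (- ?u) + exp (- (2 * ?l)) \<le> \<delta>"
        using \<open>0 < \<delta>\<close> by linarith
    qed (use l in auto)
  qed
qed

end
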